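(* Consider a $K$-user SISO interference channel with diversity order $L$ and $T$ channel extensions: $H_{ij}=\tau_{ij}^1A_1+\dots+\tau_{ij}^LA_L$ for $1\le i,j\le K$, where $A_1,\dots,A_L\in\mathbb{C}^{T\times T}$ are fixed linearly independent diagonal matrices with $(A_1,\dots,A_L)\in\Psi$. Suppose each user transmits one data stream ($d_k=1$ for all $k$). Then for almost all coefficients $(\tau_{ij}^l)\in\mathbb{C}^{K^2L}$, the DoF achievable via a vector space IA scheme is at most $$\min\left\{\sqrt{\tfrac54K},\; L+\tfrac14T\right\};$$ that is, if a single-beam vector space IA scheme exists, then its DoF $K/T$ satisfies $K/T\le\min\{\sqrt{5K/4},\,L+T/4\}$.
   Context: $\Psi$ denotes here the set of tuples $(A_1,\dots,A_L)$ of $T\times T$ complex matrices for which there exist $k_1,\dots,k_L\in\mathbb{C}$ such that $k_1A_1+\dots+k_LA_L$ has full rank $T$. A single-beam vector space interference alignment (IA) scheme is a choice of $v_k,u_k\in\mathbb{C}^{T}$, $1\le k\le K$, such that $u_k^HH_{kj}v_j=0$ for all $1\le k\neq j\le K$ and $u_k^HH_{kk}v_k\neq0$ for all $1\le k\le K$, where $(\cdot)^H$ is the conjugate transpose. Its DoF (degrees of freedom) is the total number of data streams divided by the number of channel uses, $(d_1+\dots+d_K)/T=K/T$. SISO means one antenna per transmitter and per receiver, so the channel matrices with $T$ extensions are $T\times T$ diagonal. "Almost all" is with respect to Lebesgue measure on $\mathbb{C}^{K^2L}$. *)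

theory Defs
  imports "HOL-Analysis.Analysis"
begin

text \<open>
  The sizes are cardinalities of finite index types: \<open>'t\<close> indexes the \<open>T\<close> channel extensions,
  \<open>'l\<close> the \<open>L\<close> diversity branches and \<open>'k\<close> the \<open>K\<close> users.
\<close>

definition mat_lincomb :: "('l::finite \<Rightarrow> complex) \<Rightarrow> ('l \<Rightarrow> complex^'t^'t) \<Rightarrow> complex^'t^'t" where
  "mat_lincomb c A = (\<chi> a b. \<Sum>l\<in>UNIV. c l * A l $ a $ b)"

text \<open>
  Linear independence over the complex numbers, as a family. The constant \<open>independent\<close>
  of the library is independence over the reals, and \<open>vec.independent\<close> does not apply to
  matrices.
\<close>

definition lin_indep_mats :: "('l::finite \<Rightarrow> complex^'t^'t) \<Rightarrow> bool" where
  "lin_indep_mats A \<longleftrightarrow> (\<forall>c. mat_lincomb c A = 0 \<longrightarrow> (\<forall>l. c l = 0))"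

definition diagonal_matrix :: "'a::zero^'t^'t \<Rightarrow> bool" where
  "diagonal_matrix M \<longleftrightarrow> (\<forall>a b. a \<noteq> b \<longrightarrow> M $ a $ b = 0)"

definition Psi :: "('l::finite \<Rightarrow> complex^'t^'t) set" where
  "Psi = {A :: 'l \<Rightarrow> complex^'t^'t. \<exists>c. rank (mat_lincomb c A) = CARD('t)}"

definition channel ::
  "('l::finite \<Rightarrow> complex^'t^'t) \<Rightarrow> complex^('k::finite \<times> 'k \<times> 'l) \<Rightarrow> 'k \<Rightarrow> 'k \<Rightarrow> complex^'t^'t" where
  "channel A \<tau> i j = mat_lincomb (\<lambda>l. \<tau> $ (i, j, l)) A"

text \<open>The scalar \<open>u\<^sup>H w\<close>, conjugate linear in the first argument.\<close>

definition herm_prod :: "complex^'t \<Rightarrow> complex^'t \<Rightarrow> complex" where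
  "herm_prod u w = (\<Sum>a\<in>UNIV. cnj (u $ a) * w $ a)"

definition single_beam_IA_scheme ::
  "('k \<Rightarrow> 'k \<Rightarrow> complex^'t^'t) \<Rightarrow> ('k \<Rightarrow> complex^'t) \<Rightarrow> ('k \<Rightarrow> complex^'t) \<Rightarrow> bool" where
  "single_beam_IA_scheme H v u \<longleftrightarrow>
     (\<forall>k j. k \<noteq> j \<longrightarrow> herm_prod (u k) (H k j *v v j) = 0) \<and>
     (\<forall>k. herm_prod (u k) (H k k *v v k) \<noteq> 0)"

text \<open>Total number of data streams \<open>d k\<close> of the users, per channel use.\<close>

definition dof :: "('k::finite \<Rightarrow> nat) \<Rightarrow> nat \<Rightarrow> real" where
  "dof d T = real (\<Sum>k\<in>UNIV. d k) / real T"

end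

theory Submission
  imports Defs "HOL-Computational_Algebra.Polynomial"
begin

text \<open>
  The coordinates of almost every \<open>\<tau>\<close> do not all lie in a field generated, over a fixed countable
  set, by fewer than \<open>K\<^sup>2 L\<close> numbers. Given a scheme, let \<open>M\<close> be the \<open>K \<times> K\<close> matrix of products
  \<open>u\<^sub>k\<^sup>H D v\<^sub>j\<close> for a generic invertible combination \<open>D\<close> of the \<open>A\<^sub>l\<close>, and let \<open>\<rho>\<close> be its rank. Call
  \<open>(k, j)\<close> linked if \<open>u\<^sub>k\<^sup>H A\<^sub>l v\<^sub>j \<noteq> 0\<close> for some \<open>l\<close>. Every linked pair of distinct users lets one
  coefficient be computed from the others, and every unlinked pair is a linear condition on the
  vectors. Because \<open>D\<close> is invertible, once a nonsingular \<open>\<rho> \<times> \<rho>\<close> minor of \<open>M\<close> is fixed, each further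
  user costs at most \<open>T - \<rho> - 2\<close> parameters beyond the ones it determines. On the other hand, users
  without directed cycles of links give a nonsingular minor, so a Turan argument produces about
  \<open>K\<^sup>2 / \<rho>\<close> linked pairs. If \<open>K > L T + T\<^sup>2 / 4\<close> and \<open>L \<ge> 2\<close>, fewer than \<open>K\<^sup>2 L\<close> parameters remain;
  if \<open>L = 1\<close>, then \<open>M\<close> is diagonal and \<open>K \<le> T\<close>. The square root bound follows from \<open>L \<le> T\<close>.
\<close>

subsection \<open>Generated fields\<close>

text \<open>The subfield generated by \<open>X\<close>, as an inductive set so that each membership
  proof translates into a \<open>rat_expr\<close>. The guard in \<open>inverse\<close> is what
  yields \<open>rat_defined\<close>.\<close>

inductive_set field_gen :: "complex set \<Rightarrow> complex set" for X where
  gen: "x \<in> X \<Longrightarrow> x \<in> field_gen X"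
| zero: "0 \<in> field_gen X"
| one: "1 \<in> field_gen X"
| add: "x \<in> field_gen X \<Longrightarrow> y \<in> field_gen X \<Longrightarrow> x + y \<in> field_gen X"
| uminus: "x \<in> field_gen X \<Longrightarrow> - x \<in> field_gen X"
| mult: "x \<in> field_gen X \<Longrightarrow> y \<in> field_gen X \<Longrightarrow> x * y \<in> field_gen X"
| inverse: "x \<in> field_gen X \<Longrightarrow> x \<noteq> 0 \<Longrightarrow> inverse x \<in> field_gen X"

lemma field_gen_diff: "x \<in> field_gen X \<Longrightarrow> y \<in> field_gen X \<Longrightarrow> x - y \<in> field_gen X"
  using field_gen.add[of x X "- y"] by (simp add: field_gen.uminus)

lemma field_gen_divide: "x \<in> field_gen X \<Longrightarrow> y \<in> field_gen X \<Longrightarrow> x / y \<in> field_gen X"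
  by (cases "y = 0") (auto simp: field_gen.zero divide_inverse intro: field_gen.mult field_gen.inverse)

lemma field_gen_sum: "(\<And>i. i \<in> I \<Longrightarrow> f i \<in> field_gen X) \<Longrightarrow> sum f I \<in> field_gen X"
  by (induction I rule: infinite_finite_induct) (auto intro: field_gen.zero field_gen.add)

lemma field_gen_power: "x \<in> field_gen X \<Longrightarrow> x ^ n \<in> field_gen X"
  by (induction n) (auto intro: field_gen.one field_gen.mult)

lemma field_gen_of_nat: "of_nat n \<in> field_gen X"
  by (induction n) (auto intro: field_gen.zero field_gen.one field_gen.add)

lemma field_gen_le: "X \<subseteq> field_gen Y \<Longrightarrow> field_gen X \<subseteq> field_gen Y"
proof
  fix x assume X: "X \<subseteq> field_gen Y" and "x \<in> field_gen X"
  from this(2) show "x \<in> field_gen Y"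
    by induction (use X in \<open>auto intro: field_gen.intros\<close>)
qed

lemma field_gen_mono: "X \<subseteq> Y \<Longrightarrow> field_gen X \<subseteq> field_gen Y"
  by (intro field_gen_le) (auto intro: field_gen.gen)

text \<open>
  Rational functions are represented by expressions so that there are only countably many of them;
  \<open>rat_defined\<close> excludes the junk value \<open>inverse 0 = 0\<close>.
\<close>

datatype 'n rat_expr = Var 'n | Const nat | Zero | One
  | Add "'n rat_expr" "'n rat_expr" | Neg "'n rat_expr"
  | Mul "'n rat_expr" "'n rat_expr" | Inv "'n rat_expr"

instance rat_expr :: (countable) countable
  by countable_datatype

primrec rat_eval :: "(nat \<Rightarrow> complex) \<Rightarrow> complex^'n \<Rightarrow> 'n rat_expr \<Rightarrow> complex" where
  "rat_eval c x (Var i) = x $ i"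
| "rat_eval c x (Const m) = c m"
| "rat_eval c x Zero = 0"
| "rat_eval c x One = 1"
| "rat_eval c x (Add e e') = rat_eval c x e + rat_eval c x e'"
| "rat_eval c x (Neg e) = - rat_eval c x e"
| "rat_eval c x (Mul e e') = rat_eval c x e * rat_eval c x e'"
| "rat_eval c x (Inv e) = inverse (rat_eval c x e)"

primrec rat_defined :: "(nat \<Rightarrow> complex) \<Rightarrow> complex^'n \<Rightarrow> 'n rat_expr \<Rightarrow> bool" where
  "rat_defined c x (Var i) = True"
| "rat_defined c x (Const m) = True"
| "rat_defined c x Zero = True"
| "rat_defined c x One = True"
| "rat_defined c x (Add e e') = (rat_defined c x e \<and> rat_defined c x e')"
| "rat_defined c x (Neg e) = rat_defined c x e"
| "rat_defined c x (Mul e e') = (rat_defined c x e \<and> rat_defined c x e')"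
| "rat_defined c x (Inv e) = (rat_defined c x e \<and> rat_eval c x e \<noteq> 0)"

lemma field_gen_rat_eval:
  assumes "z \<in> field_gen (F \<union> P)" "F \<subseteq> range c" "P \<subseteq> range (($) x)"
  shows "\<exists>e. rat_defined c x e \<and> rat_eval c x e = z"
  using assms(1)
proof induction
  case (gen z)
  with assms(2,3) consider m where "z = c m" | i where "z = x $ i" by blast
  then show ?case
    by cases (metis rat_eval.simps(2) rat_defined.simps(2), metis rat_eval.simps(1) rat_defined.simps(1))
next
  case zero
  show ?case by (intro exI[of _ Zero]) simp
next
  case one
  show ?case by (intro exI[of _ One]) simp
next
  case (add y z)
  then show ?case by (metis rat_eval.simps(5) rat_defined.simps(5))
next
  case (uminus y)
  then show ?case by (metis rat_eval.simps(6) rat_defined.simps(6))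
next
  case (mult y z)
  then show ?case by (metis rat_eval.simps(7) rat_defined.simps(7))
next
  case (inverse y)
  then show ?case by (metis rat_eval.simps(8) rat_defined.simps(8))
qed

lemma differentiable_rat_eval:
  "rat_defined c x e \<Longrightarrow> (\<lambda>x::complex^'n::finite. rat_eval c x e) differentiable (at x)"
proof (induction e)
  case (Var i)
  show ?case by (simp add: bounded_linear_imp_differentiable bounded_linear_vec_nth)
qed (auto intro!: differentiable_add differentiable_mult differentiable_minus differentiable_inverse)

text \<open>
  The points whose coordinates are given rational functions of fewer parameters form the image of
  a hyperplane under a differentiable map, and countably many such maps suffice.
\<close>

lemma AE_not_generated:
  fixes F :: "complex set"
  assumes "countable F"
  shows "AE \<tau> in (lebesgue :: (complex^'n::finite) measure).
           \<not> (\<exists>P. finite P \<and> card P < CARD('n) \<and> (\<forall>i. \<tau> $ i \<in> field_gen (F \<union> P)))"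
proof -
  obtain c :: "nat \<Rightarrow> complex" where c: "F \<subseteq> range c"
    using assms by (metis (no_types) range_from_nat_into countable_insert insert_not_empty subset_insertI)
  obtain i0 :: 'n where "True" by blast
  \<comment> \<open>With fewer than \<open>CARD('n)\<close> parameters one coordinate is spare, so
    every parameter vector can be placed in this hyperplane.\<close>
  define H where "H = {x :: complex^'n. x $ i0 = 0}"
  define dom where "dom E = {x \<in> H. \<forall>i. rat_defined c x (E i)}" for E :: "'n \<Rightarrow> 'n rat_expr"
  define f where "f E x = (\<chi> i. rat_eval c x (E i))" for E :: "'n \<Rightarrow> 'n rat_expr" and x
  have "negligible H"
  proof (rule negligible_subset)
    show "negligible {x :: complex^'n. axis i0 1 \<bullet> x = 0}"
      by (rule negligible_hyperplane) (simp add: axis_eq_0_iff)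
    show "H \<subseteq> {x. axis i0 1 \<bullet> x = 0}"
      by (auto simp: H_def inner_axis')
  qed
  then have "negligible (dom E)" for E
    by (rule negligible_subset) (auto simp: dom_def)
  moreover have "f E differentiable_on dom E" for E
    unfolding differentiable_on_def
  proof
    fix x assume "x \<in> dom E"
    then have "(\<lambda>x. rat_eval c x (E i)) differentiable (at x)" for i
      by (intro differentiable_rat_eval) (auto simp: dom_def)
    then obtain D where "\<And>i. ((\<lambda>x. rat_eval c x (E i)) has_derivative D i) (at x)"
      unfolding differentiable_def by metis
    then have "(f E has_derivative (\<lambda>h. \<chi> i. D i h)) (at x)"
      by (subst has_derivative_componentwise_within)
        (auto simp: f_def Basis_vec_def inner_axis intro!: has_derivative_inner_left)
    then show "f E differentiable (at x within dom E)"
      using differentiable_at_withinI differentiableI by blast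
  qed
  ultimately have "negligible (f E ` dom E)" for E
    by (intro negligible_differentiable_image_negligible) auto
  then have "negligible (\<Union>E. f E ` dom E)"
    by (intro negligible_countable_Union) auto
  then have "AE \<tau> in lebesgue. \<tau> \<notin> (\<Union>E. f E ` dom E)"
    by (intro AE_not_in) (simp add: negligible_iff_null_sets)
  then show ?thesis
  proof (rule AE_mp, intro AE_I2 impI notI)
    fix \<tau> :: "complex^'n"
    assume nin: "\<tau> \<notin> (\<Union>E. f E ` dom E)"
      and "\<exists>P. finite P \<and> card P < CARD('n) \<and> (\<forall>i. \<tau> $ i \<in> field_gen (F \<union> P))"
    then obtain P where P: "finite P" "card P < CARD('n)" "\<And>i. \<tau> $ i \<in> field_gen (F \<union> P)"
      by blast
    have "card P \<le> card (UNIV - {i0})"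
      using P(2) by simp
    then obtain h where h: "h ` P \<subseteq> UNIV - {i0}" "inj_on h P"
      using card_le_inj[OF P(1)] by (metis finite)
    \<comment> \<open>\<open>h\<close> stores each parameter in a coordinate other than
      \<open>i0\<close>; the coordinates left over, \<open>i0\<close> among them, get 0.\<close>
    define x :: "complex^'n" where "x = (\<chi> i. if i \<in> h ` P then inv_into P h i else 0)"
    have "x $ h p = p" if "p \<in> P" for p
      using that h(2) by (simp add: x_def)
    then have "P \<subseteq> range (($) x)"
      by (metis rangeI subsetI)
    then have "\<exists>e. rat_defined c x e \<and> rat_eval c x e = \<tau> $ i" for i
      using field_gen_rat_eval[OF P(3) c] by blast
    then obtain E where E: "\<And>i. rat_defined c x (E i)" "\<And>i. rat_eval c x (E i) = \<tau> $ i"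
      by metis
    have "x \<in> dom E" using E(1) h(1) by (auto simp: dom_def H_def x_def)
    moreover have "\<tau> = f E x" by (simp add: f_def E(2) vec_eq_iff)
    ultimately show False using nin by blast
  qed
qed

subsection \<open>Linear algebra over a generated field\<close>

text \<open>Index sets instead of types let one predicate serve for families of vectors and for
  minors: with \<open>card I = card J\<close> it says that the minor on \<open>I\<close> and
  \<open>J\<close> is nonsingular.\<close>

definition indep_rows :: "'i set \<Rightarrow> 'j set \<Rightarrow> ('i \<Rightarrow> 'j \<Rightarrow> complex) \<Rightarrow> bool" where
  "indep_rows I J w \<longleftrightarrow> (\<forall>c. (\<forall>j\<in>J. (\<Sum>i\<in>I. c i * w i j) = 0) \<longrightarrow> (\<forall>i\<in>I. c i = 0))"

lemma indep_rowsD: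
  "indep_rows I J w \<Longrightarrow> (\<And>j. j \<in> J \<Longrightarrow> (\<Sum>i\<in>I. c i * w i j) = 0) \<Longrightarrow> i \<in> I \<Longrightarrow> c i = 0"
  unfolding indep_rows_def by blast

lemma indep_rows_subset:
  assumes "indep_rows I J w" "I' \<subseteq> I" "finite I"
  shows "indep_rows I' J w"
  unfolding indep_rows_def
proof (intro allI impI ballI)
  fix c i assume c: "\<forall>j\<in>J. (\<Sum>i\<in>I'. c i * w i j) = 0" and i: "i \<in> I'"
  have "(\<Sum>i\<in>I. (if i \<in> I' then c i else 0) * w i j) = (\<Sum>i\<in>I'. c i * w i j)" for j
    using assms(2,3) by (intro sum.mono_neutral_cong_right) auto
  then show "c i = 0"
    using indep_rowsD[OF assms(1), of "\<lambda>i. if i \<in> I' then c i else 0" i] c i assms(2) by auto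
qed

text \<open>
  Gaussian elimination. The coefficients \<open>a\<close>, \<open>b\<close> recover a vector \<open>x\<close> from its products with
  the rows \<open>w i\<close> and its coordinates in \<open>J'\<close>; they lie in the field of the entries of \<open>w\<close>.
\<close>

lemma elimination:
  assumes "finite I" "finite J" "indep_rows I J w" "\<And>i j. i \<in> I \<Longrightarrow> j \<in> J \<Longrightarrow> w i j \<in> field_gen X"
  obtains J' a b where "J' \<subseteq> J" "card J' + card I = card J"
    "\<forall>t i. a t i \<in> field_gen X" "\<forall>t j. b t j \<in> field_gen X"
    "\<forall>x. \<forall>t\<in>J. x t = (\<Sum>i\<in>I. a t i * (\<Sum>j\<in>J. w i j * x j)) + (\<Sum>j\<in>J'. b t j * x j)"
proof -
  have "\<exists>J' a b. J' \<subseteq> J \<and> card J' + card I = card J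
     \<and> (\<forall>t i. a t i \<in> field_gen X) \<and> (\<forall>t j. b t j \<in> field_gen X)
     \<and> (\<forall>x. \<forall>t\<in>J. x t = (\<Sum>i\<in>I. a t i * (\<Sum>j\<in>J. w i j * x j)) + (\<Sum>j\<in>J'. b t j * x j))"
  using assms
  proof (induction I rule: finite_induct)
    case empty
    have "x t = (\<Sum>j\<in>J. (if t = j then 1 else 0) * x j)" if "t \<in> J" for x :: "'b \<Rightarrow> complex" and t
      using that empty by (subst sum.cong[of J J _ "\<lambda>j. if t = j then x j else 0"]) auto
    then have *: "\<forall>x. \<forall>t\<in>J. x t = (\<Sum>i\<in>{}. 0 * (\<Sum>j\<in>J. w i j * x j))
        + (\<Sum>j\<in>J. (if t = j then 1 else 0) * x j)"
      by simp
    show ?case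
    proof (rule exI[of _ J], rule exI[of _ "\<lambda>_ _. 0"],
        rule exI[of _ "\<lambda>t j. if t = j then 1 else 0"], intro conjI)
      show "\<forall>x. \<forall>t\<in>J. x t = (\<Sum>i\<in>{}. 0 * (\<Sum>j\<in>J. w i j * x j))
          + (\<Sum>j\<in>J. (if t = j then 1 else 0) * x j)"
        by (rule *)
    qed (simp_all add: field_gen.zero field_gen.one)
  next
    case (insert i0 I)
    have "indep_rows I J w"
      using insert.hyps(1) by (intro indep_rows_subset[OF insert.prems(2)]) auto
    then obtain J' a b where J': "J' \<subseteq> J" "card J' + card I = card J"
      and a: "\<And>t i. a t i \<in> field_gen X" and b: "\<And>t j. b t j \<in> field_gen X"
      and ab: "\<And>x t. t \<in> J \<Longrightarrow>
         x t = (\<Sum>i\<in>I. a t i * (\<Sum>j\<in>J. w i j * x j)) + (\<Sum>j\<in>J'. b t j * x j)"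
      using insert.IH[OF insert.prems(1) _ insert.prems(3)] by blast
    have finJ': "finite J'" using J' insert(4) finite_subset by blast
    \<comment> \<open>\<open>\<alpha>\<close> and \<open>\<beta>\<close> express the product with
      the new row \<open>i0\<close> by the products with the old rows and the coordinates still
      free.\<close>
    define \<alpha> where "\<alpha> i = (\<Sum>t\<in>J. w i0 t * a t i)" for i
    define \<beta> where "\<beta> j = (\<Sum>t\<in>J. w i0 t * b t j)" for j
    have w: "w i0 j \<in> field_gen X" if "j \<in> J" for j
      using insert.prems that by blast
    have \<alpha>: "\<alpha> i \<in> field_gen X" and \<beta>: "\<beta> i' \<in> field_gen X" for i i'
      unfolding \<alpha>_def \<beta>_def using a b w by (auto intro!: field_gen_sum field_gen.mult)
    have prod: "(\<Sum>t\<in>J. w i0 t * x t)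
        = (\<Sum>i\<in>I. \<alpha> i * (\<Sum>j\<in>J. w i j * x j)) + (\<Sum>j\<in>J'. \<beta> j * x j)" for x
    proof -
      have "(\<Sum>t\<in>J. w i0 t * x t) = (\<Sum>t\<in>J. w i0 t * ((\<Sum>i\<in>I. a t i * (\<Sum>j\<in>J. w i j * x j)) + (\<Sum>j\<in>J'. b t j * x j)))"
        by (intro sum.cong refl arg_cong2[of _ _ _ _ "(*)"] ab)
      also have "\<dots> = (\<Sum>t\<in>J. \<Sum>i\<in>I. w i0 t * a t i * (\<Sum>j\<in>J. w i j * x j))
          + (\<Sum>t\<in>J. \<Sum>j\<in>J'. w i0 t * b t j * x j)"
        by (simp only: distrib_left sum.distrib sum_distrib_left mult.assoc)
      also have "\<dots> = (\<Sum>i\<in>I. \<Sum>t\<in>J. w i0 t * a t i * (\<Sum>j\<in>J. w i j * x j))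
          + (\<Sum>j\<in>J'. \<Sum>t\<in>J. w i0 t * b t j * x j)"
        by (simp only: sum.swap[of _ J])
      finally show ?thesis
        unfolding \<alpha>_def \<beta>_def by (simp only: sum_distrib_right)
    qed
    \<comment> \<open>Without a pivot, row \<open>i0\<close> would be a combination of the rows in
      \<open>I\<close>, as testing on unit vectors shows.\<close>
    have "\<exists>j0\<in>J'. \<beta> j0 \<noteq> 0"
    proof (rule ccontr)
      assume "\<not> ?thesis"
      then have *: "(\<Sum>t\<in>J. w i0 t * x t) = (\<Sum>i\<in>I. \<alpha> i * (\<Sum>j\<in>J. w i j * x j))" for x
        by (simp add: prod)
      have "(\<Sum>i\<in>insert i0 I. (if i = i0 then 1 else - \<alpha> i) * w i j) = 0" if "j \<in> J" for j
      proof -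
        have d: "(\<Sum>t\<in>J. w i t * (if t = j then 1 else 0)) = w i j" for i
          using that insert(4) by (subst sum.cong[of J J _ "\<lambda>t. if t = j then w i t else 0"]) auto
        have "(\<Sum>i\<in>I. (if i = i0 then 1 else - \<alpha> i) * w i j) = (\<Sum>i\<in>I. - (\<alpha> i * w i j))"
          using insert(2) by (intro sum.cong) auto
        then show ?thesis
          using *[of "\<lambda>t. if t = j then 1 else 0"] insert(1,2) by (simp add: d sum_negf)
      qed
      from indep_rowsD[OF insert(5) this, of i0] show False by simp
    qed
    then obtain j0 where j0: "j0 \<in> J'" "\<beta> j0 \<noteq> 0" by blast
    \<comment> \<open>Solve the expression of the new product for the pivot coordinate
      \<open>x j0\<close> and substitute it into the old formula.\<close>
    define a' where "a' t i = (if i = i0 then b t j0 / \<beta> j0 else a t i - b t j0 * \<alpha> i / \<beta> j0)" for t i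
    define b' where "b' t j = b t j - b t j0 * \<beta> j / \<beta> j0" for t j
    have 1: "x t = (\<Sum>i\<in>insert i0 I. a' t i * (\<Sum>j\<in>J. w i j * x j)) + (\<Sum>j\<in>J'-{j0}. b' t j * x j)"
      if t: "t \<in> J" for x t
    proof -
      define S0 where "S0 = (\<Sum>t\<in>J. w i0 t * x t)"
      define S1 where "S1 = (\<Sum>i\<in>I. \<alpha> i * (\<Sum>j\<in>J. w i j * x j))"
      define S2 where "S2 = (\<Sum>j\<in>J'-{j0}. \<beta> j * x j)"
      define S3 where "S3 = (\<Sum>i\<in>I. a t i * (\<Sum>j\<in>J. w i j * x j))"
      define S4 where "S4 = (\<Sum>j\<in>J'-{j0}. b t j * x j)"
      have "S0 = S1 + (\<beta> j0 * x j0 + S2)"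
        unfolding S0_def S1_def S2_def 
        by (subst prod) (simp add: sum.remove[OF finJ' j0(1)])
      then have x0: "x j0 = (S0 - S1 - S2) / \<beta> j0"
        using j0(2) by (simp add: field_simps)
      have xt: "x t = S3 + (b t j0 * x j0 + S4)"
      
        unfolding S3_def S4_def by (subst ab[OF t]) (simp add: sum.remove[OF finJ' j0(1)])
      have "(\<Sum>i\<in>I. a' t i * (\<Sum>j\<in>J. w i j * x j))
          = (\<Sum>i\<in>I. a t i * (\<Sum>j\<in>J. w i j * x j) - b t j0 / \<beta> j0 * (\<alpha> i * (\<Sum>j\<in>J. w i j * x j)))"
        using insert(2) by (intro sum.cong) (auto simp: a'_def left_diff_distrib)
      then have 1: "(\<Sum>i\<in>insert i0 I. a' t i * (\<Sum>j\<in>J. w i j * x j))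
          = b t j0 / \<beta> j0 * S0 + (S3 - b t j0 / \<beta> j0 * S1)"
        using insert(1,2) unfolding S0_def S1_def S3_def
        by (simp add: sum_subtractf sum_distrib_left[symmetric] sum_divide_distrib[symmetric] a'_def[of t i0])
      have "(\<Sum>j\<in>J'-{j0}. b' t j * x j) = (\<Sum>j\<in>J'-{j0}. b t j * x j - b t j0 / \<beta> j0 * (\<beta> j * x j))"
        by (intro sum.cong) (auto simp: b'_def left_diff_distrib)
      then have 2: "(\<Sum>j\<in>J'-{j0}. b' t j * x j) = S4 - b t j0 / \<beta> j0 * S2"
        unfolding S4_def S2_def by (simp add: sum_subtractf sum_distrib_left[symmetric] sum_divide_distrib[symmetric])
      show ?thesis
        unfolding 1 2 xt x0 by (simp add: diff_divide_distrib right_diff_distrib)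
    qed
    have 2: "a' t i \<in> field_gen X" "b' t j \<in> field_gen X" for t i j
      unfolding a'_def b'_def using a b \<alpha> \<beta>
      by (auto intro!: field_gen_diff field_gen_divide field_gen.mult)
    have 3: "J' - {j0} \<subseteq> J" using J' by blast
    have 4: "card (J' - {j0}) + card (insert i0 I) = card J"
    proof -
      have "card J' = Suc (card (J' - {j0}))"
        using card.remove[OF finJ' j0(1)] by simp
      then show ?thesis using J'(2) insert(1,2) by simp
    qed
    show ?case
      by (rule exI[of _ "J' - {j0}"], rule exI[of _ a'], rule exI[of _ b'])
        (intro conjI allI ballI 1 2 3 4)
  qed
  then obtain J' a b where "J' \<subseteq> J" "card J' + card I = card J"
    "\<forall>t i. a t i \<in> field_gen X" "\<forall>t j. b t j \<in> field_gen X"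
    "\<forall>x. \<forall>t\<in>J. x t = (\<Sum>i\<in>I. a t i * (\<Sum>j\<in>J. w i j * x j)) + (\<Sum>j\<in>J'. b t j * x j)"
    by blast
  then show thesis
    by (rule that)
qed

text \<open>This is \<open>elimination\<close> over \<open>field_gen UNIV\<close>, where membership
  of the entries is automatic; the bound is read off from
  \<open>card J' + card I = card J\<close>.\<close>

lemma indep_rows_card:
  fixes w :: "'a \<Rightarrow> 'b \<Rightarrow> complex"
  assumes "finite I" "finite J" "indep_rows I J w"
  shows "card I \<le> card J"
proof -
  have w: "w i j \<in> field_gen UNIV" if "i \<in> I" "j \<in> J" for i j by (simp add: field_gen.gen)
  obtain J' a b where "J' \<subseteq> J" "card J' + card I = card J"
    and "\<forall>t i. a t i \<in> field_gen UNIV" "\<forall>t j. b t j \<in> field_gen UNIV"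
    "\<forall>x. \<forall>t\<in>J. x t = (\<Sum>i\<in>I. a t i * (\<Sum>j\<in>J. w i j * x j)) + (\<Sum>j\<in>J'. b t j * x j)"
    by (rule elimination[OF assms w])
  from this(2) show ?thesis by simp
qed

text \<open>When the cardinalities agree no coordinate stays free, so the coefficients
  \<open>a\<close> form the inverse matrix; testing on unit vectors gives its product with
  \<open>w\<close>.\<close>

lemma indep_rows_square:
  assumes "finite I" "finite J" "indep_rows I J w" "card I = card J"
    and "\<And>i j. i \<in> I \<Longrightarrow> j \<in> J \<Longrightarrow> w i j \<in> field_gen X"
  obtains a where "\<forall>t i. a t i \<in> field_gen X"
    "\<forall>x. \<forall>t\<in>J. x t = (\<Sum>i\<in>I. a t i * (\<Sum>j\<in>J. w i j * x j))"
    "\<forall>t\<in>J. \<forall>j\<in>J. (\<Sum>i\<in>I. a t i * w i j) = (if t = j then 1 else 0)"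
proof -
  obtain J' a b where J': "J' \<subseteq> J" "card J' + card I = card J"
    and a: "\<forall>t i. a t i \<in> field_gen X" and b: "\<forall>t j. b t j \<in> field_gen X"
    and x: "\<forall>x. \<forall>t\<in>J. x t = (\<Sum>i\<in>I. a t i * (\<Sum>j\<in>J. w i j * x j)) + (\<Sum>j\<in>J'. b t j * x j)"
    by (rule elimination[OF assms(1-3) assms(5)])
  have "J' = {}" using J' assms(2,4) finite_subset[of J' J] by simp
  then have x': "x t = (\<Sum>i\<in>I. a t i * (\<Sum>j\<in>J. w i j * x j))" if "t \<in> J" for x t
    using x[THEN spec[of _ x], THEN bspec, OF that] by simp
  moreover have "(\<Sum>i\<in>I. a t i * w i j) = (if t = j then 1 else 0)" if "t \<in> J" "j \<in> J" for t j
  proof -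
    have "(\<Sum>j'\<in>J. w i j' * (if j' = j then 1 else 0)) = w i j" for i
      using that assms(2) by (subst sum.cong[of J J _ "\<lambda>j'. if j' = j then w i j' else 0"]) auto
    then show ?thesis
      using x'[OF that(1), of "\<lambda>j'. if j' = j then 1 else 0"] by simp
  qed
  ultimately show ?thesis
    by (intro that[OF a] allI ballI)
qed

lemma indep_rows_transpose:
  assumes "finite I" "finite J" "indep_rows I J w" "card I = card J"
  shows "indep_rows J I (\<lambda>j i. w i j)"
  unfolding indep_rows_def
proof (intro allI impI ballI)
  fix c t assume c: "\<forall>i\<in>I. (\<Sum>j\<in>J. c j * w i j) = 0" and t: "t \<in> J"
  have w: "w i j \<in> field_gen UNIV" if "i \<in> I" "j \<in> J" for i j by (simp add: field_gen.gen)
  obtain a where "\<forall>t i. a t i \<in> field_gen UNIV"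
    and a: "\<forall>x. \<forall>t\<in>J. x t = (\<Sum>i\<in>I. a t i * (\<Sum>j\<in>J. w i j * x j))"
    "\<forall>t\<in>J. \<forall>j\<in>J. (\<Sum>i\<in>I. a t i * w i j) = (if t = j then 1 else 0)"
    by (rule indep_rows_square[OF assms w])
  from a(1)[THEN spec[of _ c], THEN bspec, OF t] c show "c t = 0" by (simp add: mult.commute)
qed

lemma indep_rows_solve:
  assumes "finite I" "finite J" "indep_rows I J w" "card I = card J"
  shows "\<exists>c. \<forall>j\<in>J. y j = (\<Sum>i\<in>I. c i * w i j)"
proof -
  have w: "w i j \<in> field_gen UNIV" if "i \<in> I" "j \<in> J" for i j by (simp add: field_gen.gen)
  obtain a where "\<forall>t i. a t i \<in> field_gen UNIV"
    "\<forall>x. \<forall>t\<in>J. x t = (\<Sum>i\<in>I. a t i * (\<Sum>j\<in>J. w i j * x j))"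
    and a: "\<forall>t\<in>J. \<forall>j\<in>J. (\<Sum>i\<in>I. a t i * w i j) = (if t = j then 1 else 0)"
    by (rule indep_rows_square[OF assms w])
  have "(\<Sum>i\<in>I. (\<Sum>t\<in>J. y t * a t i) * w i j) = y j" if "j \<in> J" for j
  proof -
    have "(\<Sum>i\<in>I. (\<Sum>t\<in>J. y t * a t i) * w i j) = (\<Sum>t\<in>J. y t * (\<Sum>i\<in>I. a t i * w i j))"
      by (subst sum_distrib_right, subst sum.swap) (simp add: sum_distrib_left mult.assoc)
    also have "\<dots> = (\<Sum>t\<in>J. if t = j then y t else 0)"
      using that by (intro sum.cong) (auto simp: a)
    finally show ?thesis using that assms(2) by simp
  qed
  then show ?thesis
    by (intro exI[of _ "\<lambda>i. \<Sum>t\<in>J. y t * a t i"]) simp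
qed

lemma indep_rows_insert:
  assumes "finite I" "indep_rows I J w" "i0 \<notin> I"
    and "\<not> (\<exists>c. \<forall>j\<in>J. w i0 j = (\<Sum>i\<in>I. c i * w i j))"
  shows "indep_rows (insert i0 I) J w"
  unfolding indep_rows_def
proof (intro allI impI)
  fix c assume c: "\<forall>j\<in>J. (\<Sum>i\<in>insert i0 I. c i * w i j) = 0"
  then have *: "c i0 * w i0 j = - (\<Sum>i\<in>I. c i * w i j)" if "j \<in> J" for j
    using that assms(1,3) by (simp add: eq_neg_iff_add_eq_0)
  have "c i0 = 0"
  proof (rule ccontr)
    assume "c i0 \<noteq> 0"
    have "w i0 j = (\<Sum>i\<in>I. (- c i / c i0) * w i j)" if "j \<in> J" for j
    proof -
      have "w i0 j = - (\<Sum>i\<in>I. c i * w i j) / c i0"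
        using *[OF that] \<open>c i0 \<noteq> 0\<close> by (simp add: field_simps)
      also have "\<dots> = (\<Sum>i\<in>I. (- c i / c i0) * w i j)"
        by (simp add: sum_negf sum_divide_distrib)
      finally show ?thesis .
    qed
    then have "\<exists>c. \<forall>j\<in>J. w i0 j = (\<Sum>i\<in>I. c i * w i j)"
      by (intro exI[of _ "\<lambda>i. - c i / c i0"]) blast
    with assms(4) show False ..
  qed
  moreover have "c i = 0" if "i \<in> I" for i
  proof (rule indep_rowsD[OF assms(2), of c])
    show "(\<Sum>i\<in>I. c i * w i j) = 0" if "j \<in> J" for j
      using *[OF that] \<open>c i0 = 0\<close> by simp
  qed (rule that)
  ultimately show "\<forall>i\<in>insert i0 I. c i = 0" by blast
qed

section \<open>Row bases and maximal minors\<close>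

lemma row_basis:
  assumes "finite I"
  shows "\<exists>Q\<subseteq>I. indep_rows Q J w \<and> (\<forall>i\<in>I. \<exists>c. \<forall>j\<in>J. w i j = (\<Sum>q\<in>Q. c q * w q j))"
proof -
  have "\<exists>Q. (Q \<subseteq> I \<and> indep_rows Q J w) \<and> (\<forall>Q'. Q' \<subseteq> I \<and> indep_rows Q' J w \<longrightarrow> card Q' \<le> card Q)"
    by (rule ex_has_greatest_nat[of _ "{}" card "Suc (card I)"])
      (use assms in \<open>auto simp: indep_rows_def less_Suc_eq_le intro: card_mono\<close>)
  then obtain Q where Q: "Q \<subseteq> I" "indep_rows Q J w"
    and max: "\<And>Q'. Q' \<subseteq> I \<Longrightarrow> indep_rows Q' J w \<Longrightarrow> card Q' \<le> card Q" by blast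
  have fin: "finite Q" using Q assms finite_subset by blast
  have "\<exists>c. \<forall>j\<in>J. w i j = (\<Sum>q\<in>Q. c q * w q j)" if i: "i \<in> I" for i
  proof (cases "i \<in> Q")
    case True
    have "w i j = (\<Sum>q\<in>Q. (if q = i then 1 else 0) * w q j)" for j
      using True fin by (subst sum.cong[of Q Q _ "\<lambda>q. if q = i then w q j else 0"]) auto
    then show ?thesis by (intro exI[of _ "\<lambda>q. if q = i then 1 else 0"] ballI)
  next
    case False
    show ?thesis
    proof (rule ccontr)
      assume "\<not> ?thesis"
      then have "card (insert i Q) \<le> card Q"
        using Q i False fin by (intro max indep_rows_insert) auto
      then show False using False fin by simp
    qed
  qed
  then show ?thesis using Q by blast
qed

text \<open>A nonsingular minor of maximal size is bordered only by singular ones.\<close>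

lemma maximal_minor:
  fixes M :: "'k::finite \<Rightarrow> 'k \<Rightarrow> complex"
  assumes "indep_rows S S M"
  obtains I J where "S \<subseteq> I" "S \<subseteq> J" "card I = card J" "indep_rows I J M"
    "\<forall>k. \<exists>c. \<forall>j. M k j = (\<Sum>i\<in>I. c i * M i j)"
proof -
  \<comment> \<open>Only minors that contain \<open>S\<close> compete. Bordering keeps
    \<open>S\<close>, so a maximal one still spans all rows.\<close>
  define P where "P = (\<lambda>(I, J). S \<subseteq> I \<and> S \<subseteq> J \<and> card I = card J \<and> indep_rows I J M)"
  have "\<exists>IJ. P IJ \<and> (\<forall>IJ'. P IJ' \<longrightarrow> card (fst IJ') \<le> card (fst IJ))"
  proof (rule ex_has_greatest_nat[of _ "(S, S)" _ "Suc CARD('k)"])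
    show "P (S, S)" using assms by (simp add: P_def)
    show "\<forall>IJ. P IJ \<longrightarrow> card (fst IJ) < Suc CARD('k)"
      by (auto simp: less_Suc_eq_le intro: card_mono)
  qed
  then obtain I J where P: "P (I, J)" and max: "\<And>I' J'. P (I', J') \<Longrightarrow> card I' \<le> card I"
    by force
  then have IJ: "S \<subseteq> I" "S \<subseteq> J" "card I = card J" "indep_rows I J M"
    by (auto simp: P_def)
  have "\<exists>c. \<forall>j. M k j = (\<Sum>i\<in>I. c i * M i j)" for k
  proof (cases "k \<in> I")
    case True
    have "M k j = (\<Sum>q\<in>I. (if q = k then 1 else 0) * M q j)" for j
      using True by (subst sum.cong[of I I _ "\<lambda>q. if q = k then M q j else 0"]) auto
    then show ?thesis by (intro exI[of _ "\<lambda>q. if q = k then 1 else 0"] allI)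
  next
    case k: False
    obtain c where c: "\<And>j. j \<in> J \<Longrightarrow> M k j = (\<Sum>i\<in>I. c i * M i j)"
      using indep_rows_solve[OF _ _ IJ(4,3), of "M k"] by auto
    have "M k j = (\<Sum>i\<in>I. c i * M i j)" for j
    proof (rule ccontr)
      assume ne: "M k j \<noteq> (\<Sum>i\<in>I. c i * M i j)"
      then have j: "j \<notin> J" using c by blast
      \<comment> \<open>Independence on \<open>J\<close> forces any representation of row
        \<open>k\<close> to agree with \<open>c\<close>, which fails at column \<open>j\<close>; the
        bordered minor would thus be nonsingular and larger.\<close>
      have "indep_rows (insert k I) (insert j J) M"
      proof (rule indep_rows_insert)
        show "indep_rows I (insert j J) M"
          using IJ(4) unfolding indep_rows_def by blast
        show "\<nexists>c. \<forall>j\<in>insert j J. M k j = (\<Sum>i\<in>I. c i * M i j)"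
        proof
          assume "\<exists>c. \<forall>j\<in>insert j J. M k j = (\<Sum>i\<in>I. c i * M i j)"
          then obtain c' where c': "\<And>j'. j' \<in> insert j J \<Longrightarrow> M k j' = (\<Sum>i\<in>I. c' i * M i j')" by blast
          have "c' i - c i = 0" if "i \<in> I" for i
          proof (rule indep_rowsD[OF IJ(4), of "\<lambda>i. c' i - c i"])
            show "(\<Sum>i\<in>I. (c' i - c i) * M i j) = 0" if "j \<in> J" for j
              using c[OF that] c'[of j] that by (simp add: left_diff_distrib sum_subtractf)
          qed (rule that)
          then have "(\<Sum>i\<in>I. c' i * M i j) = (\<Sum>i\<in>I. c i * M i j)"
            by (intro sum.cong) auto
          then show False using ne c' by auto
        qed
      qed (use k in auto)
      then have "P (insert k I, insert j J)"
        using IJ k j by (auto simp: P_def)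
      from max[OF this] k show False by simp
    qed
    then show ?thesis by blast
  qed
  then show ?thesis by (intro that[OF IJ] allI)
qed

subsection \<open>Acyclic sets of users\<close>

text \<open>Each new vertex has no arrow to an earlier one, which excludes directed cycles through
  two or more vertices. Loops are ignored, as every user is linked to itself.\<close>

inductive acyclic_in :: "('k \<times> 'k) set \<Rightarrow> 'k set \<Rightarrow> bool" for N where
  empty: "acyclic_in N {}"
| insert: "acyclic_in N S \<Longrightarrow> k \<notin> S \<Longrightarrow> (\<And>j. j \<in> S \<Longrightarrow> (k, j) \<notin> N) \<Longrightarrow> acyclic_in N (insert k S)"

text \<open>A vertex of least out-degree is kept and its out-neighbours, itself included, are
  discarded. The discarded terms sum to at most 1, and the out-degrees of the rest can only drop, so
  their terms can only grow.\<close>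

lemma acyclic_in_greedy:
  fixes N :: "('k::finite \<times> 'k) set"
  assumes "\<And>k. (k, k) \<in> N"
  shows "\<exists>S\<subseteq>X. acyclic_in N S \<and> (\<Sum>k\<in>X. 1 / real (card {j\<in>X. (k, j) \<in> N})) \<le> card S"
proof (induction "card X" arbitrary: X rule: less_induct)
  case less
  show ?case
  proof (cases "X = {}")
    case True
    then show ?thesis using acyclic_in.empty by auto
  next
    case False
    define deg where "deg Y k = card {j\<in>Y. (k, j) \<in> N}" for Y k
    obtain k where k: "k \<in> X" "\<And>j. j \<in> X \<Longrightarrow> deg X k \<le> deg X j"
      using ex_min_if_finite[of "deg X ` X"] False
      by (metis (no_types, lifting) arg_min_if_finite(1) arg_min_least finite)
    define A where "A = {j\<in>X. (k, j) \<in> N}"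
    define X' where "X' = X - A"
    have kA: "k \<in> A" using k assms by (simp add: A_def)
    have "card X' < card X"
      using k(1) kA by (intro psubset_card_mono) (auto simp: X'_def)
    from less[OF this] obtain S where S: "S \<subseteq> X'" "acyclic_in N S"
      "(\<Sum>k\<in>X'. 1 / real (deg X' k)) \<le> card S"
      unfolding deg_def by blast
    have pos: "deg Y j > 0" if "j \<in> Y" for Y j
      unfolding deg_def using that assms by (auto simp: card_gt_0_iff)
    have "(\<Sum>j\<in>A. 1 / real (deg X j)) \<le> (\<Sum>j\<in>A. 1 / real (card A))"
    proof (intro sum_mono frac_le)
      fix j assume "j \<in> A"
      then show "real (card A) \<le> real (deg X j)"
        using k(2)[of j] by (simp add: A_def deg_def)
      show "0 < real (card A)" using kA by (auto simp: card_gt_0_iff)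
    qed auto
    also have "\<dots> = 1" using kA by auto
    finally have 1: "(\<Sum>j\<in>A. 1 / real (deg X j)) \<le> 1" .
    have "(\<Sum>j\<in>X'. 1 / real (deg X j)) \<le> (\<Sum>j\<in>X'. 1 / real (deg X' j))"
    proof (intro sum_mono frac_le)
      fix j assume "j \<in> X'"
      then show "0 < real (deg X' j)" using pos by simp
      show "real (deg X' j) \<le> real (deg X j)"
        unfolding deg_def X'_def by (auto intro!: card_mono)
    qed auto
    with 1 S(3) have "(\<Sum>j\<in>A. 1 / real (deg X j)) + (\<Sum>j\<in>X'. 1 / real (deg X j)) \<le> Suc (card S)"
      by simp
    also have "(\<Sum>j\<in>A. 1 / real (deg X j)) + (\<Sum>j\<in>X'. 1 / real (deg X j)) = (\<Sum>j\<in>X. 1 / real (deg X j))"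
      unfolding X'_def by (subst add.commute, intro sum.subset_diff[symmetric]) (auto simp: A_def)
    finally have "(\<Sum>j\<in>X. 1 / real (deg X j)) \<le> card (insert k S)"
      using S(1) kA by (auto simp: X'_def card_insert_if)
    moreover have "acyclic_in N (insert k S)"
      using S kA by (intro acyclic_in.insert) (auto simp: X'_def A_def)
    moreover have "insert k S \<subseteq> X" using S k by (auto simp: X'_def)
    ultimately show ?thesis unfolding deg_def by blast
  qed
qed

text \<open>A directed form of Turan's theorem.\<close>

lemma acyclic_in_card:
  fixes N :: "('k::finite \<times> 'k) set"
  assumes "\<And>k. (k, k) \<in> N"
  obtains S where "acyclic_in N S" "(card X)\<^sup>2 \<le> card S * card (N \<inter> X \<times> X)"
proof -
  define deg where "deg k = card {j\<in>X. (k, j) \<in> N}" for k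
  obtain S where S: "acyclic_in N S" "(\<Sum>k\<in>X. 1 / real (deg k)) \<le> card S"
    using acyclic_in_greedy[OF assms, of X] unfolding deg_def by blast
  have pos: "deg k > 0" if "k \<in> X" for k
    unfolding deg_def using that assms by (auto simp: card_gt_0_iff)
  \<comment> \<open>Cauchy-Schwarz bounds the sum of reciprocal out-degrees below by the square of
    \<open>card X\<close> over the number of pairs of \<open>N\<close> within
    \<open>X\<close>.\<close>
  have "(\<Sum>k\<in>X. (1 / sqrt (real (deg k))) * sqrt (real (deg k)))\<^sup>2
      \<le> (\<Sum>k\<in>X. (1 / sqrt (real (deg k)))\<^sup>2) * (\<Sum>k\<in>X. (sqrt (real (deg k)))\<^sup>2)"
    by (rule Cauchy_Schwarz_ineq_sum)
  also have "(\<Sum>k\<in>X. (1 / sqrt (real (deg k))) * sqrt (real (deg k))) = real (card X)"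
    using pos by (simp add: sum.cong[of X X _ "\<lambda>_. 1"])
  also have "(\<Sum>k\<in>X. (1 / sqrt (real (deg k)))\<^sup>2) = (\<Sum>k\<in>X. 1 / real (deg k))"
    by (simp add: power_divide)
  also have "(\<Sum>k\<in>X. (sqrt (real (deg k)))\<^sup>2) = real (\<Sum>k\<in>X. deg k)"
    by simp
  also have "(\<Sum>k\<in>X. deg k) = card (SIGMA k:X. {j\<in>X. (k, j) \<in> N})"
    unfolding deg_def by (subst card_SigmaI) auto
  also have "(SIGMA k:X. {j\<in>X. (k, j) \<in> N}) = N \<inter> X \<times> X"
    by auto
  also have "(\<Sum>k\<in>X. 1 / real (deg k)) * real (card (N \<inter> X \<times> X))
      \<le> card S * card (N \<inter> X \<times> X)"
    using S(2) by (simp add: mult_right_mono)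
  finally have "(card X)\<^sup>2 \<le> card S * card (N \<inter> X \<times> X)"
    by (simp flip: of_nat_power of_nat_mult)
  with S(1) show ?thesis by (rule that)
qed

text \<open>In the order of insertion the minor is triangular with nonzero diagonal: row
  \<open>k\<close> vanishes in the earlier columns.\<close>

lemma acyclic_in_indep_rows:
  fixes M :: "'k::finite \<Rightarrow> 'k \<Rightarrow> complex"
  assumes "acyclic_in N S" "\<And>k. M k k \<noteq> 0" "\<And>k j. (k, j) \<notin> N \<Longrightarrow> M k j = 0"
  shows "indep_rows S S M"
  using assms(1)
proof induction
  case empty
  show ?case by (simp add: indep_rows_def)
next
  case (insert S k)
  show ?case
    unfolding indep_rows_def
  proof (intro allI impI)
    fix c assume c: "\<forall>j\<in>insert k S. (\<Sum>i\<in>insert k S. c i * M i j) = 0"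
    have 0: "c i = 0" if "i \<in> S" for i
    proof (rule indep_rowsD[OF insert.IH, of c])
      show "(\<Sum>i\<in>S. c i * M i j) = 0" if "j \<in> S" for j
        using c that insert assms(3) by auto
    qed (rule that)
    have "(\<Sum>i\<in>S. c i * M i k) = 0" using 0 by simp
    with c insert(2) assms(2)[of k] have "c k = 0" by auto
    with 0 show "\<forall>i\<in>insert k S. c i = 0" by blast
  qed
qed

subsection \<open>Parameter count of a scheme\<close>

text \<open>Counts adjoined numbers in place of a transcendence degree; such counts add up from
  stage to stage.\<close>

definition generated :: "complex set \<Rightarrow> nat \<Rightarrow> complex set \<Rightarrow> bool" where
  "generated X n Y \<longleftrightarrow> (\<exists>P. finite P \<and> card P \<le> n \<and> Y \<subseteq> field_gen (X \<union> P))"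

lemma generatedI:
  "finite P \<Longrightarrow> card P \<le> n \<Longrightarrow> (\<And>y. y \<in> Y \<Longrightarrow> y \<in> field_gen (X \<union> P)) \<Longrightarrow> generated X n Y"
  unfolding generated_def by blast

lemma generated_finite: "finite Y \<Longrightarrow> card Y \<le> n \<Longrightarrow> generated X n Y"
  by (rule generatedI[of Y]) (auto intro: field_gen.gen)

lemma generated_0: "generated X 0 Y \<Longrightarrow> Y \<subseteq> field_gen X"
  unfolding generated_def by auto

text \<open>The conclusion keeps \<open>Y\<close> beside \<open>Z\<close> so that later stages may
  use everything generated before.\<close>

lemma generated_trans:
  assumes "generated X m Y" "generated (X \<union> Y) n Z"
  shows "generated X (m + n) (Y \<union> Z)"
proof -
  obtain P where P: "finite P" "card P \<le> m" "Y \<subseteq> field_gen (X \<union> P)"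
    using assms(1) unfolding generated_def by blast
  obtain Q where Q: "finite Q" "card Q \<le> n" "Z \<subseteq> field_gen (X \<union> Y \<union> Q)"
    using assms(2) unfolding generated_def by blast
  have Y: "Y \<subseteq> field_gen (X \<union> (P \<union> Q))"
    using P(3) field_gen_mono[of "X \<union> P" "X \<union> (P \<union> Q)"] by blast
  moreover have "field_gen (X \<union> Y \<union> Q) \<subseteq> field_gen (X \<union> (P \<union> Q))"
    using Y by (intro field_gen_le) (auto intro: field_gen.gen)
  moreover have "card (P \<union> Q) \<le> m + n"
    using card_Un_le[of P Q] P(2) Q(2) by linarith
  ultimately show ?thesis
    using P(1) Q(1,3) by (intro generatedI[of "P \<union> Q"]) auto
qed

lemma generated_UN:
  assumes "finite I" "\<And>i. i \<in> I \<Longrightarrow> generated X n (Y i)"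
  shows "generated X (card I * n) (\<Union>i\<in>I. Y i)"
proof -
  obtain P where P: "\<And>i. i \<in> I \<Longrightarrow> finite (P i) \<and> card (P i) \<le> n \<and> Y i \<subseteq> field_gen (X \<union> P i)"
    using assms(2) unfolding generated_def by metis
  show ?thesis
  proof (rule generatedI[of "\<Union>i\<in>I. P i"])
    show "card (\<Union>i\<in>I. P i) \<le> card I * n"
      using card_UN_le[OF assms(1), of P] sum_bounded_above[of I "\<lambda>i. card (P i)" n] P
      by force
    show "y \<in> field_gen (X \<union> (\<Union>i\<in>I. P i))" if y: "y \<in> (\<Union>i\<in>I. Y i)" for y
    proof -
      obtain i where i: "i \<in> I" "y \<in> field_gen (X \<union> P i)" using y P by blast
      then have "X \<union> P i \<subseteq> X \<union> (\<Union>i\<in>I. P i)" by blast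
      from field_gen_mono[OF this] i(2) show ?thesis by blast
    qed
  qed (use assms(1) P in auto)
qed

text \<open>Each independent linear condition with a known right-hand side saves one parameter: the
  coordinates that \<open>elimination\<close> leaves free generate the rest.\<close>

lemma generated_solve:
  assumes "finite I" "finite J" "indep_rows I J w"
    and "\<And>i j. i \<in> I \<Longrightarrow> j \<in> J \<Longrightarrow> w i j \<in> field_gen X"
    and "\<And>i. i \<in> I \<Longrightarrow> (\<Sum>j\<in>J. w i j * x j) \<in> field_gen X"
  shows "generated X (card J - card I) (x ` J)"
proof -
  obtain J' a b where J': "J' \<subseteq> J" "card J' + card I = card J"
    and a: "\<forall>t i. a t i \<in> field_gen X" and b: "\<forall>t j. b t j \<in> field_gen X"
    and x: "\<forall>x. \<forall>t\<in>J. x t = (\<Sum>i\<in>I. a t i * (\<Sum>j\<in>J. w i j * x j)) + (\<Sum>j\<in>J'. b t j * x j)"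
    by (rule elimination[OF assms(1-4)])
  have fin: "finite J'" using J'(1) assms(2) finite_subset by blast
  have mono: "z \<in> field_gen (X \<union> x ` J')" if "z \<in> field_gen X" for z
    using field_gen_mono[of X "X \<union> x ` J'"] that by blast
  show ?thesis
  proof (rule generatedI[of "x ` J'"])
    show "card (x ` J') \<le> card J - card I"
      using card_image_le[OF fin, of x] J'(2) by linarith
    fix y assume "y \<in> x ` J"
    then obtain t where t: "t \<in> J" "y = x t" by blast
    have "(\<Sum>i\<in>I. a t i * (\<Sum>j\<in>J. w i j * x j)) + (\<Sum>j\<in>J'. b t j * x j) \<in> field_gen (X \<union> x ` J')"
    proof (intro field_gen.add field_gen_sum)
      show "a t i * (\<Sum>j\<in>J. w i j * x j) \<in> field_gen (X \<union> x ` J')" if "i \<in> I" for i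
        using a by (intro field_gen.mult mono assms(5)[OF that]) blast
      show "b t j * x j \<in> field_gen (X \<union> x ` J')" if "j \<in> J'" for j
        by (rule field_gen.mult[OF mono field_gen.gen]) (use b that in auto)
    qed
    then show "y \<in> field_gen (X \<union> x ` J')"
      unfolding t(2) using x[THEN spec[of _ x], THEN bspec, OF t(1)] by simp
  qed (use fin in simp)
qed

section \<open>Gram matrices and the count of parameters\<close>

definition gram :: "('k \<Rightarrow> 't::finite \<Rightarrow> complex) \<Rightarrow> ('k \<Rightarrow> 't \<Rightarrow> complex) \<Rightarrow> 'k \<Rightarrow> 'k \<Rightarrow> complex" where
  "gram u v k j = (\<Sum>t\<in>UNIV. u k t * v j t)"

text \<open>The pairings are bilinear. In the application \<open>u\<close> absorbs the conjugation
  and the diagonal of \<open>D\<close>, while \<open>g l\<close> is the diagonal of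
  \<open>A l\<close> divided by that of \<open>D\<close>, so \<open>D\<close> cancels here.\<close>

definition branch_gram ::
  "('l \<Rightarrow> 't::finite \<Rightarrow> complex) \<Rightarrow> ('k \<Rightarrow> 't \<Rightarrow> complex) \<Rightarrow> ('k \<Rightarrow> 't \<Rightarrow> complex) \<Rightarrow>
    'l \<Rightarrow> 'k \<Rightarrow> 'k \<Rightarrow> complex" where
  "branch_gram g u v l k j = (\<Sum>t\<in>UNIV. g l t * u k t * v j t)"

definition links ::
  "('l \<Rightarrow> 't::finite \<Rightarrow> complex) \<Rightarrow> ('k \<Rightarrow> 't \<Rightarrow> complex) \<Rightarrow> ('k \<Rightarrow> 't \<Rightarrow> complex) \<Rightarrow>
    ('k \<times> 'k) set" where
  "links g u v = {(k, j). \<exists>l. branch_gram g u v l k j \<noteq> 0}"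

text \<open>
  Order of generation: the Gram entries of the rows \<open>I\<close> and columns \<open>J\<close> (a vanishing entry is free,
  a nonvanishing one is paid for by a coefficient \<open>\<tau>\<close>, see below); \<open>u\<close> on \<open>I\<close>; \<open>v\<close> on \<open>J\<close>; a basis \<open>Q\<close>
  of the components \<open>w\<close> of the \<open>u k\<close> orthogonal to all \<open>v j\<close>; the remaining \<open>v j\<close>, constrained by
  \<open>u\<close> on \<open>I\<close> and by \<open>Q\<close>; the remaining \<open>u k\<close>, combinations of \<open>u\<close> on \<open>I\<close> and of \<open>Q\<close>; and finally \<open>\<tau>\<close>, where each
  pair of distinct linked users determines one coefficient by its alignment equation.
\<close>

lemma scheme_generated:
  fixes u v :: "'k::finite \<Rightarrow> 't::finite \<Rightarrow> complex" and g :: "'l::finite \<Rightarrow> 't \<Rightarrow> complex"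
    and \<tau> :: "'k \<times> 'k \<times> 'l \<Rightarrow> complex"
  defines "M \<equiv> gram u v" and "B \<equiv> branch_gram g u v" and "N \<equiv> links g u v"
  assumes g: "\<And>l t. g l t \<in> field_gen F"
    and diag: "\<And>k. (k, k) \<in> N"
    and M_N: "\<And>k j. (k, j) \<notin> N \<Longrightarrow> M k j = 0"
    and align: "\<And>k j. k \<noteq> j \<Longrightarrow> (\<Sum>l\<in>UNIV. \<tau> (k, j, l) * B l k j) = 0"
    and IJ: "card I = card J" "indep_rows I J M" "\<And>k. \<exists>c. \<forall>j. M k j = (\<Sum>i\<in>I. c i * M i j)"
    and norm_u: "\<And>k. k \<notin> I \<Longrightarrow> \<exists>j\<in>J. M k j = 1"
    and norm_v: "\<And>j. j \<notin> J \<Longrightarrow> \<exists>i\<in>I. M i j = 1"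
  shows "\<exists>n q. card I + q \<le> CARD('t) \<and> generated F n (range \<tau>) \<and>
    int n \<le> int CARD('k \<times> 'k \<times> 'l) + int CARD('k) - int (card (N \<inter> (- I) \<times> (- J)))
      - 2 * (int CARD('k) - int (card I)) + int (card I) * int CARD('t)
      + (int CARD('k) + int q) * (int CARD('t) - int (card I))"
proof -
  have M_eq: "M k j = (\<Sum>t\<in>UNIV. u k t * v j t)" for k j
    by (simp add: M_def gram_def)
  have N_eq: "N = {(k, j). \<exists>l. B l k j \<noteq> 0}"
    by (simp add: N_def B_def links_def)
  have M_sum: "(\<Sum>i\<in>A. c i * M i j) = (\<Sum>t\<in>UNIV. (\<Sum>i\<in>A. c i * u i t) * v j t)" for A c j
    unfolding M_eq sum_distrib_left sum_distrib_right by (subst sum.swap) (simp add: mult.assoc)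
  define R where "R = I \<times> UNIV \<union> UNIV \<times> J"
  obtain s where s: "\<And>k. k \<notin> I \<Longrightarrow> s k \<in> J" "\<And>k. k \<notin> I \<Longrightarrow> M k (s k) = 1"
    using norm_u by metis
  obtain s' where s': "\<And>j. j \<notin> J \<Longrightarrow> s' j \<in> I" "\<And>j. j \<notin> J \<Longrightarrow> M (s' j) j = 1"
    using norm_v by metis
  \<comment> \<open>One entry normalised to 1 for each row outside \<open>I\<close> and each column
    outside \<open>J\<close>. The two families are disjoint: the first uses rows outside
    \<open>I\<close>, the second rows in \<open>I\<close>.\<close>
  define Sc where "Sc = (\<lambda>k. (k, s k)) ` (- I) \<union> (\<lambda>j. (s' j, j)) ` (- J)"
  have card_Sc: "card Sc = card (- I) + card (- J)"
    unfolding Sc_def using s(1) s'(1)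
    by (subst card_Un_disjoint) (auto simp: card_image inj_on_def)
  have Sc1: "M k j = 1" if "(k, j) \<in> Sc" for k j
    using that s s' by (auto simp: Sc_def)
  have Sc: "Sc \<subseteq> N \<inter> R"
  proof
    fix p assume p: "p \<in> Sc"
    then have "p \<in> N" using Sc1[of "fst p" "snd p"] M_N[of "fst p" "snd p"] by auto
    moreover have "p \<in> R" using p s s' by (auto simp: Sc_def R_def)
    ultimately show "p \<in> N \<inter> R" by blast
  qed
  define Y0 where "Y0 = (\<lambda>(k, j). M k j) ` (N \<inter> R - Sc)"
  have Y0: "M k j \<in> field_gen (F \<union> Y0)" if kj: "(k, j) \<in> R" for k j
  proof -
    consider "(k, j) \<notin> N" | "(k, j) \<in> Sc" | "(k, j) \<in> N \<inter> R - Sc" using kj by blast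
    then show ?thesis
      by cases (auto simp: M_N Sc1 Y0_def intro: field_gen.zero field_gen.one field_gen.gen)
  qed
  have gen0: "generated F (card (N \<inter> R) - card Sc) Y0"
    unfolding Y0_def using Sc
    by (intro generated_finite) (auto intro: order.trans[OF card_image_le] simp: card_Diff_subset)

  define Y1 where "Y1 = (\<Union>i\<in>I. range (u i))"
  have u_Y1: "u i t \<in> Y1" if "i \<in> I" for i t
    using that unfolding Y1_def by blast
  have gen1: "generated (F \<union> Y0) (card I * CARD('t)) Y1"
    unfolding Y1_def by (intro generated_UN generated_finite) (auto intro: card_image_le)

  define Y2 where "Y2 = (\<Union>j\<in>J. range (v j))"
  have v_Y2: "v j t \<in> Y2" if "j \<in> J" for j t
    using that unfolding Y2_def by blast
  \<comment> \<open>Pairing a relation among the \<open>u i\<close> with the \<open>v j\<close>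
    gives a relation among the rows of the minor.\<close>
  have indep_u: "indep_rows I UNIV u"
    unfolding indep_rows_def
  proof (intro allI impI ballI)
    fix c i assume "\<forall>t\<in>UNIV. (\<Sum>i\<in>I. c i * u i t) = 0" "i \<in> I"
    then show "c i = 0"
      by (intro indep_rowsD[OF IJ(2), of c]) (simp_all add: M_sum)
  qed
  have gen2: "generated (F \<union> Y0 \<union> Y1) (card J * (CARD('t) - card I)) Y2"
    unfolding Y2_def
  proof (rule generated_UN)
    fix j assume j: "j \<in> J"
    show "generated (F \<union> Y0 \<union> Y1) (CARD('t) - card I) (range (v j))"
    proof (rule generated_solve[OF _ _ indep_u])
      show "u i t \<in> field_gen (F \<union> Y0 \<union> Y1)" if "i \<in> I" for i t
        using that by (intro field_gen.gen) (use u_Y1 in auto)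
      show "(\<Sum>t\<in>UNIV. u i t * v j t) \<in> field_gen (F \<union> Y0 \<union> Y1)" for i
        using Y0[of i j] field_gen_mono[of "F \<union> Y0" "F \<union> Y0 \<union> Y1"] j by (auto simp: R_def M_eq)
    qed auto
  qed simp

  obtain c where c: "\<And>k j. M k j = (\<Sum>i\<in>I. c k i * M i j)"
    using IJ(3) by metis
  \<comment> \<open>Row \<open>k\<close> of \<open>M\<close> is the combination \<open>c k\<close>
    of the rows in \<open>I\<close>; subtracting the same combination of the \<open>u i\<close>
    leaves a vector whose products with all \<open>v j\<close> vanish.\<close>
  define w where "w k t = u k t - (\<Sum>i\<in>I. c k i * u i t)" for k t
  have w_v: "(\<Sum>t\<in>UNIV. w k t * v j t) = 0" for k j
    using c[of k j] unfolding M_sum unfolding M_eq w_def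
    by (simp add: left_diff_distrib sum_subtractf)
  obtain Q where Q: "indep_rows Q UNIV w" "\<And>k. \<exists>d. \<forall>t. w k t = (\<Sum>q\<in>Q. d q * w q t)"
    using row_basis[of "UNIV :: 'k set" UNIV w] by auto
  define Y3 where "Y3 = (\<Union>q\<in>Q. range (w q))"
  have w_Y3: "w q t \<in> Y3" if "q \<in> Q" for q t
    using that unfolding Y3_def by blast
  have indep_v: "indep_rows J UNIV v"
    unfolding indep_rows_def
  proof (intro allI impI ballI)
    fix b j assume b: "\<forall>t\<in>UNIV. (\<Sum>j\<in>J. b j * v j t) = 0" and j: "j \<in> J"
    have "(\<Sum>j\<in>J. b j * M i j) = (\<Sum>t\<in>UNIV. u i t * (\<Sum>j\<in>J. b j * v j t))" for i
      unfolding M_eq sum_distrib_left by (subst sum.swap) (simp add: mult.left_commute)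
    then have "(\<Sum>j\<in>J. b j * M i j) = 0" for i using b by simp
    then show "b j = 0"
      using indep_rowsD[OF indep_rows_transpose[OF _ _ IJ(2,1)], of b j] j by simp
  qed
  have gen3: "generated (F \<union> Y0 \<union> Y1 \<union> Y2) (card Q * (CARD('t) - card J)) Y3"
    unfolding Y3_def
  proof (rule generated_UN)
    fix q assume "q \<in> Q"
    show "generated (F \<union> Y0 \<union> Y1 \<union> Y2) (CARD('t) - card J) (range (w q))"
    proof (rule generated_solve[OF _ _ indep_v])
      show "v j t \<in> field_gen (F \<union> Y0 \<union> Y1 \<union> Y2)" if "j \<in> J" for j t
        using that by (intro field_gen.gen) (use v_Y2 in auto)
      show "(\<Sum>t\<in>UNIV. v j t * w q t) \<in> field_gen (F \<union> Y0 \<union> Y1 \<union> Y2)" for j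
        using w_v[of q j] by (simp add: mult.commute field_gen.zero)
    qed auto
  qed simp

  define Y4 where "Y4 = (\<Union>j\<in>- J. range (v j))"
  have v_Y4: "v j t \<in> Y4" if "j \<notin> J" for j t
    using that unfolding Y4_def by blast
  define X3 where "X3 = F \<union> Y0 \<union> Y1 \<union> Y2 \<union> Y3"
  \<comment> \<open>Pairing with the \<open>v j\<close> removes the part from \<open>Q\<close>, so
    the minor kills the coefficients on \<open>I\<close>; independence of \<open>Q\<close> then
    kills the others.\<close>
  have indep_uw: "indep_rows (I <+> Q) UNIV (case_sum u w)"
    unfolding indep_rows_def
  proof (intro allI impI)
    fix b :: "'k + 'k \<Rightarrow> complex"
    assume b: "\<forall>t\<in>UNIV. (\<Sum>i\<in>I <+> Q. b i * case_sum u w i t) = 0"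
    have b': "(\<Sum>i\<in>I. b (Inl i) * u i t) + (\<Sum>q\<in>Q. b (Inr q) * w q t) = 0" for t
      using b[THEN bspec, of t] by (simp add: sum.Plus)
    have "(\<Sum>t\<in>UNIV. (\<Sum>q\<in>Q. b (Inr q) * w q t) * v j t) = 0" for j
    proof -
      have "(\<Sum>t\<in>UNIV. (\<Sum>q\<in>Q. b (Inr q) * w q t) * v j t)
          = (\<Sum>q\<in>Q. b (Inr q) * (\<Sum>t\<in>UNIV. w q t * v j t))"
        unfolding sum_distrib_left sum_distrib_right by (subst sum.swap) (simp add: mult.assoc)
      then show ?thesis by (simp add: w_v)
    qed
    moreover have "(\<Sum>i\<in>I. b (Inl i) * u i t) = - (\<Sum>q\<in>Q. b (Inr q) * w q t)" for t
      using b'[of t] by (simp add: eq_neg_iff_add_eq_0)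
    ultimately have "(\<Sum>i\<in>I. b (Inl i) * M i j) = 0" for j
      by (simp add: M_sum sum_negf)
    then have 1: "b (Inl i) = 0" if "i \<in> I" for i
      using indep_rowsD[OF IJ(2), of "\<lambda>i. b (Inl i)"] that by blast
    then have "(\<Sum>q\<in>Q. b (Inr q) * w q t) = 0" for t
      using b'[of t] by simp
    then have "b (Inr q) = 0" if "q \<in> Q" for q
      using indep_rowsD[OF Q(1), of "\<lambda>q. b (Inr q)"] that by blast
    with 1 show "\<forall>i\<in>I <+> Q. b i = 0" by blast
  qed
  have card_uw: "card (I <+> Q) = card I + card Q" by (simp add: card_Plus)
  have le: "card I + card Q \<le> CARD('t)"
    using indep_rows_card[OF _ _ indep_uw] card_uw by simp
  have gen4: "generated X3 (card (- J) * (CARD('t) - (card I + card Q))) Y4"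
    unfolding Y4_def
  proof (rule generated_UN)
    fix j
    show "generated X3 (CARD('t) - (card I + card Q)) (range (v j))"
      unfolding card_uw[symmetric]
    proof (rule generated_solve[OF _ _ indep_uw])
      show "case_sum u w i t \<in> field_gen X3" if "i \<in> I <+> Q" for i t
        using that by (intro field_gen.gen) (use u_Y1 w_Y3 in \<open>auto simp: X3_def\<close>)
      show "(\<Sum>t\<in>UNIV. case_sum u w i t * v j t) \<in> field_gen X3" if "i \<in> I <+> Q" for i
      proof (cases i)
        case (Inl k)
        then have "M k j \<in> field_gen (F \<union> Y0)"
          using that by (intro Y0) (auto simp: R_def)
        then have "M k j \<in> field_gen X3"
          using field_gen_mono[of "F \<union> Y0" X3] by (auto simp: X3_def)
        then show ?thesis by (simp add: Inl M_eq)
      qed (simp add: w_v field_gen.zero)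
    qed auto
  qed simp

  define Y5 where "Y5 = (\<Union>k\<in>- I. range (u k))"
  have u_Y5: "u k t \<in> Y5" if "k \<notin> I" for k t
    using that unfolding Y5_def by blast
  have gen5: "generated (X3 \<union> Y4) (card (- I) * card Q) Y5"
    unfolding Y5_def
  proof (rule generated_UN)
    fix k
    obtain d where d: "\<And>t. w k t = (\<Sum>q\<in>Q. d q * w q t)" using Q(2) by blast
    have M_X4: "M k j \<in> field_gen (X3 \<union> Y4)" if "j \<in> J" for k j
      using Y0[of k j] that field_gen_mono[of "F \<union> Y0" "X3 \<union> Y4"] by (auto simp: X3_def R_def)
    \<comment> \<open>The coefficients \<open>c k\<close> cost nothing: the columns \<open>J\<close>
      give a square system, and \<open>card I - card J\<close> is 0.\<close>
    have "generated (X3 \<union> Y4) (card I - card J) (c k ` I)"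
    proof (rule generated_solve[OF _ _ indep_rows_transpose[OF _ _ IJ(2,1)]])
      show "(\<Sum>i\<in>I. M i j * c k i) \<in> field_gen (X3 \<union> Y4)" if "j \<in> J" for j
        using M_X4[OF that, of k] c[of k j] by (simp add: mult.commute)
    qed (auto intro: M_X4)
    then have c_X4: "c k i \<in> field_gen (X3 \<union> Y4)" if "i \<in> I" for i
      using generated_0 that IJ(1) by auto
    have mono: "z \<in> field_gen (X3 \<union> Y4 \<union> d ` Q)" if "z \<in> field_gen (X3 \<union> Y4)" for z
      using field_gen_mono[of "X3 \<union> Y4" "X3 \<union> Y4 \<union> d ` Q"] that by blast
    show "generated (X3 \<union> Y4) (card Q) (range (u k))"
    proof (rule generatedI[of "d ` Q"])
      fix y assume "y \<in> range (u k)"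
      then obtain t where t: "y = u k t" by blast
      have "u k t = (\<Sum>i\<in>I. c k i * u i t) + (\<Sum>q\<in>Q. d q * w q t)"
        using d[of t] by (simp add: w_def[of k] diff_eq_eq add.commute)
      also have "\<dots> \<in> field_gen (X3 \<union> Y4 \<union> d ` Q)"
      proof (intro field_gen.add field_gen_sum)
        show "c k i * u i t \<in> field_gen (X3 \<union> Y4 \<union> d ` Q)" if "i \<in> I" for i
          using that by (intro field_gen.mult[OF mono[OF c_X4] mono[OF field_gen.gen]])
            (use u_Y1 in \<open>auto simp: X3_def\<close>)
        show "d q * w q t \<in> field_gen (X3 \<union> Y4 \<union> d ` Q)" if "q \<in> Q" for q
          using that by (intro field_gen.mult field_gen.gen) (use w_Y3 in \<open>auto simp: X3_def\<close>)
      qed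
      finally show "y \<in> field_gen (X3 \<union> Y4 \<union> d ` Q)" unfolding t .
    qed (auto intro: card_image_le)
  qed simp

  define X5 where "X5 = X3 \<union> Y4 \<union> Y5"
  have u_X5: "u k t \<in> field_gen X5" and v_X5: "v k t \<in> field_gen X5" for k t
    using u_Y1[of k t] v_Y2[of k t] v_Y4[of k t] u_Y5[of k t]
    by (auto simp: X5_def X3_def intro!: field_gen.gen)
  have B_X5: "B l k j \<in> field_gen X5" for l k j
    unfolding B_def branch_gram_def
    using g field_gen_mono[of F X5] by (intro field_gen_sum field_gen.mult u_X5 v_X5) (auto simp: X5_def X3_def)
  define sel where "sel k j = (SOME l. B l k j \<noteq> 0)" for k j
  have sel: "B (sel k j) k j \<noteq> 0" if "(k, j) \<in> N" for k j
    using that someI_ex[of "\<lambda>l. B l k j \<noteq> 0"] unfolding N_eq sel_def by blast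
  \<comment> \<open>For each linked pair of distinct users, the coefficient of one nonvanishing
    branch, to be recovered from the alignment equation.\<close>
  define E where "E = (\<lambda>(k, j). (k, j, sel k j)) ` (N - Id)"
  have gen6: "generated X5 (card (- E)) (range \<tau>)"
  proof (rule generatedI[of "\<tau> ` (- E)"])
    fix y assume "y \<in> range \<tau>"
    then obtain k j l where y: "y = \<tau> (k, j, l)" by auto
    show "y \<in> field_gen (X5 \<union> \<tau> ` (- E))"
    proof (cases "(k, j, l) \<in> E")
      case False
      then show ?thesis by (auto simp: y intro: field_gen.gen)
    next
      case True
      then have kj: "(k, j) \<in> N" "k \<noteq> j" "l = sel k j" by (auto simp: E_def)
      have "(\<Sum>l'\<in>UNIV. \<tau> (k, j, l') * B l' k j)
          = \<tau> (k, j, l) * B l k j + (\<Sum>l'\<in>UNIV - {l}. \<tau> (k, j, l') * B l' k j)"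
        by (rule sum.remove) auto
      with align[OF kj(2)]
      have "\<tau> (k, j, l) * B l k j = - (\<Sum>l'\<in>UNIV - {l}. \<tau> (k, j, l') * B l' k j)"
        by (simp add: eq_neg_iff_add_eq_0)
      then have "\<tau> (k, j, l) = - (\<Sum>l'\<in>UNIV - {l}. \<tau> (k, j, l') * B l' k j) / B l k j"
        using sel[OF kj(1)] kj(3) by (simp add: field_simps)
      also have "\<dots> \<in> field_gen (X5 \<union> \<tau> ` (- E))"
      proof (intro field_gen_divide field_gen.uminus field_gen_sum field_gen.mult)
        show "\<tau> (k, j, l') \<in> field_gen (X5 \<union> \<tau> ` (- E))" if "l' \<in> UNIV - {l}" for l'
          using that kj(3) by (intro field_gen.gen) (auto simp: E_def)
        show "B l' k j \<in> field_gen (X5 \<union> \<tau> ` (- E))" for l'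
          using B_X5 field_gen_mono[of X5 "X5 \<union> \<tau> ` (- E)"] by blast
        then show "B l k j \<in> field_gen (X5 \<union> \<tau> ` (- E))" .
      qed
      finally show ?thesis unfolding y .
    qed
  qed (auto intro: card_image_le)

  \<comment> \<open>The \<open>card Q\<close> parameters of each \<open>u k\<close> outside
    \<open>I\<close> offset the \<open>card Q\<close> extra conditions on each \<open>v j\<close>
    outside \<open>J\<close>.\<close>
  define n where "n = card (N \<inter> R) - card Sc + card I * CARD('t) + card J * (CARD('t) - card I)
     + card Q * (CARD('t) - card J) + card (- J) * (CARD('t) - (card I + card Q))
     + card (- I) * card Q + card (- E)"
  have "generated F n (Y0 \<union> Y1 \<union> Y2 \<union> Y3 \<union> Y4 \<union> Y5 \<union> range \<tau>)"
    unfolding n_def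
    by (intro generated_trans gen0)
      (use gen1 gen2 gen3 gen4 gen5 gen6 in \<open>simp_all add: X3_def X5_def Un_assoc\<close>)
  then have "generated F n (range \<tau>)"
    unfolding generated_def by blast
  moreover have "int n \<le> int CARD('k \<times> 'k \<times> 'l) + int CARD('k) - int (card (N \<inter> (- I) \<times> (- J)))
      - 2 * (int CARD('k) - int (card I)) + int (card I) * int CARD('t)
      + (int CARD('k) + int (card Q)) * (int CARD('t) - int (card I))"
  proof -
    have "card E = card (N - Id)"
      unfolding E_def by (intro card_image) (auto simp: inj_on_def)
    also have "\<dots> = card N - CARD('k)"
    proof -
      have "N - Id = N - (\<lambda>k. (k, k)) ` UNIV" by auto
      moreover have "card ((\<lambda>k::'k. (k, k)) ` UNIV) = CARD('k)"
        by (intro card_image) (auto simp: inj_on_def)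
      ultimately show ?thesis using diag by (simp add: card_Diff_subset image_subset_iff)
    qed
    finally have E: "card E = card N - CARD('k)" .
    have K: "CARD('k) \<le> card N"
    proof -
      have "card ((\<lambda>k::'k. (k, k)) ` UNIV) \<le> card N"
        using diag by (intro card_mono) auto
      then show ?thesis by (subst (asm) card_image) (auto simp: inj_on_def)
    qed
    have E': "int (card (- E)) = int CARD('k \<times> 'k \<times> 'l) - (int (card N) - int CARD('k))"
      using E K card_mono[of UNIV E] by (simp add: Compl_eq_Diff_UNIV card_Diff_subset of_nat_diff)
    have I': "int (card (- I)) = int CARD('k) - int (card I)" "int (card (- J)) = int CARD('k) - int (card I)"
      using card_mono[of UNIV I] card_mono[of UNIV J] IJ(1)
      by (simp_all add: Compl_eq_Diff_UNIV card_Diff_subset of_nat_diff)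
    have S': "int (card (N \<inter> R) - card Sc) = int (card (N \<inter> R)) - (int (card (- I)) + int (card (- J)))"
      using card_mono[of "N \<inter> R" Sc] Sc card_Sc by (simp add: of_nat_diff)
    \<comment> \<open>Up to the corrections for normalised entries and the diagonal, a link inside
      \<open>R\<close> costs a Gram entry and recovers a coefficient, so only the links outside
      \<open>R\<close> give a gain.\<close>
    have "card N = card (N \<inter> R) + card (N \<inter> (- I) \<times> (- J))"
    proof -
      have "N = (N \<inter> R) \<union> (N \<inter> (- I) \<times> (- J))" by (auto simp: R_def)
      moreover have "card (N \<inter> R \<union> N \<inter> (- I) \<times> (- J)) = card (N \<inter> R) + card (N \<inter> (- I) \<times> (- J))"
        by (intro card_Un_disjoint) (auto simp: R_def)
      ultimately show ?thesis by metis
    qed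
    then have N': "int (card (N \<inter> R)) = int (card N) - int (card (N \<inter> (- I) \<times> (- J)))"
      by simp
    have T': "int (CARD('t) - card I) = int CARD('t) - int (card I)"
      "int (CARD('t) - (card I + card Q)) = int CARD('t) - int (card I) - int (card Q)"
      using le by (simp_all add: of_nat_diff)
    show ?thesis
      unfolding n_def of_nat_add of_nat_mult IJ(1)[symmetric] S' E' T' I' N'
      by (simp add: algebra_simps)
  qed
  ultimately show ?thesis using le by blast
qed

section \<open>The numerical inequality\<close>

lemma counting_polynomial:
  fixes r s :: real
  assumes "0 \<le> r" "0 \<le> s"
  shows "16 * (r\<^sup>2 + r^3 + r\<^sup>2 * s + r * s\<^sup>2)
    < ((r + s)\<^sup>2 + 8 * (r + s) + 1) * ((r - s)\<^sup>2 + 4 * r + 8 * s + 1)"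
proof -
  \<comment> \<open>Here \<open>r\<close> is the rank and \<open>s\<close> is \<open>T - r\<close>.
    The first factor is \<open>4 * K\<close> for the smallest admissible \<open>K\<close>, the
    second is \<open>4 * (K - r * (s + 1))\<close>. On the right-hand side only the term with
    \<open>s - r\<close> can be negative.\<close>
  have eq: "((r + s)\<^sup>2 + 8 * (r + s) + 1) * ((r - s)\<^sup>2 + 4 * r + 8 * s + 1)
      - 16 * (r\<^sup>2 + r^3 + r\<^sup>2 * s + r * s\<^sup>2)
    = ((r + s)\<^sup>2 * ((r - s - 2)\<^sup>2 + 14) + 4 * s * ((s - r) * (r + 3 * s)))
      + (60 * r * s + 48 * s\<^sup>2 + 12 * r + 16 * s + 1)"
    by (simp add: algebra_simps power2_eq_square power3_eq_cube)
  have "0 \<le> (r + s)\<^sup>2 * ((r - s - 2)\<^sup>2 + 14) + 4 * s * ((s - r) * (r + 3 * s))"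
  proof (cases "r \<le> s")
    case True
    then show ?thesis using assms by simp
  next
    case False
    have "s * (r + 3 * s) \<le> (r + s)\<^sup>2"
    proof -
      have "s * s \<le> r * r" using False assms by (intro mult_mono) auto
      moreover have "s * s \<le> r * s" using False assms by (intro mult_right_mono) auto
      ultimately show ?thesis by (simp add: algebra_simps power2_eq_square)
    qed
    then have "(r - s) * (s * (r + 3 * s)) \<le> (r - s) * (r + s)\<^sup>2"
      using False by (intro mult_left_mono) auto
    moreover have "0 \<le> (r + s)\<^sup>2 * ((r - s - 4)\<^sup>2 + 2)" by simp
    \<comment> \<open>Moving the centre of the square from 2 to 4 releases
      \<open>4 * (r - s)\<close>, enough to absorb the negative term.\<close>
    moreover have "(r + s)\<^sup>2 * ((r - s - 2)\<^sup>2 + 14) + 4 * s * ((s - r) * (r + 3 * s))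
      = (r + s)\<^sup>2 * ((r - s - 4)\<^sup>2 + 2)
        + 4 * ((r - s) * (r + s)\<^sup>2 - (r - s) * (s * (r + 3 * s)))"
      by (simp add: algebra_simps power2_eq_square)
    ultimately show ?thesis by simp
  qed
  moreover have "0 < 60 * r * s + 48 * s\<^sup>2 + 12 * r + 16 * s + 1"
    using assms by (intro add_nonneg_pos add_nonneg_nonneg) auto
  ultimately show ?thesis using eq by linarith
qed

text \<open>In the application \<open>a\<close> is the size of a largest acyclic set,
  \<open>x\<close> the number of users outside both \<open>I\<close> and \<open>J\<close>, and
  \<open>N\<close> the number of links outside the rows \<open>I\<close> and columns
  \<open>J\<close>. The conclusion puts the count of \<open>scheme_generated\<close> below the
  number of coefficients.\<close>

lemma counting_inequality:
  fixes K T r a q x N :: real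
  assumes "0 < a" "a \<le> r" "r + q \<le> T" "0 \<le> q" "3 * r \<le> K" "T\<^sup>2 + 8 * T + 1 \<le> 4 * K"
    and x: "K - 2 * r + a \<le> x" "x\<^sup>2 \<le> a * N"
  shows "- K + 2 * r + r * T + (K + q) * (T - r) < N"
proof -
  define y where "y = K - 2 * r"
  define s where "s = T - r"
  have r: "0 < r" and y: "r \<le> y" and s: "0 \<le> s" using assms by (auto simp: y_def s_def)
  \<comment> \<open>The quotient \<open>(y + a)^2 / a\<close> decreases for
    \<open>a \<le> y\<close>, so the worst case is \<open>a = r\<close>.\<close>
  have "(y + r)\<^sup>2 * a \<le> (y + a)\<^sup>2 * r"
  proof -
    have "a * r \<le> y * y" using assms r y by (intro mult_mono) auto
    then have "0 \<le> (r - a) * (y * y - a * r)" using assms by simp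
    then show ?thesis by (simp add: algebra_simps power2_eq_square)
  qed
  also have "(y + a)\<^sup>2 * r \<le> x\<^sup>2 * r"
    using x(1) y r assms by (intro mult_right_mono power_mono) (auto simp: y_def)
  also have "x\<^sup>2 * r \<le> a * N * r"
    using x(2) r by (intro mult_right_mono) auto
  finally have "(y + r)\<^sup>2 * a \<le> (N * r) * a" by (simp add: mult_ac)
  then have 1: "(K - r)\<^sup>2 \<le> N * r"
    using assms(1) by (simp add: y_def)
  \<comment> \<open>\<open>K0\<close> is the least \<open>K\<close> that the hypothesis on
    \<open>T\<close> allows. Both factors of \<open>K * (K - r * (s + 1))\<close> grow with
    \<open>K\<close>, so a comparison at \<open>K0\<close> is enough.\<close>
  define K0 where "K0 = ((r + s)\<^sup>2 + 8 * (r + s) + 1) / 4"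
  define L0 where "L0 = ((r - s)\<^sup>2 + 4 * r + 8 * s + 1) / 4"
  have KL: "K0 \<le> K" "0 \<le> K0" "0 \<le> L0"
    using assms(6) by (simp add: K0_def s_def) (use r s in \<open>simp_all add: K0_def L0_def\<close>)
  have KL': "K0 - r * (s + 1) = L0"
    unfolding K0_def L0_def by (simp add: field_simps power2_eq_square)
  have "r\<^sup>2 + r^3 + r\<^sup>2 * s + r * s\<^sup>2 < K0 * L0"
    using counting_polynomial[of r s] r s unfolding K0_def L0_def by simp
  also have "K0 * L0 \<le> K * (K - r * (s + 1))"
    using KL KL' by (intro mult_mono) auto
  finally have 2: "r\<^sup>2 + r^3 + r\<^sup>2 * s + r * s\<^sup>2 < K * (K - r * (s + 1))" .
  have "r * (- K + 2 * r + r * T + (K + q) * (T - r)) \<le> r * (- K + 2 * r + r * T + (K + s) * s)"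
    using r s assms by (intro mult_left_mono add_left_mono mult_mono) (auto simp: s_def)
  also have "\<dots> < (K - r)\<^sup>2"
    using 2 by (simp add: s_def algebra_simps power2_eq_square power3_eq_cube)
  also have "\<dots> \<le> r * N" using 1 by (simp add: mult.commute)
  finally show ?thesis using r by simp
qed

text \<open>A maximal minor is grown from a largest acyclic set \<open>S\<close>. Since
  \<open>I\<close> and \<open>J\<close> both contain \<open>S\<close>, their union has at most
  \<open>2 * card I - card S\<close> elements, and the directed Turan bound on the remaining users
  supplies the links.\<close>

lemma scheme_bound:
  fixes u v :: "'k::finite \<Rightarrow> 't::finite \<Rightarrow> complex" and g :: "'l::finite \<Rightarrow> 't \<Rightarrow> complex"
    and \<tau> :: "'k \<times> 'k \<times> 'l \<Rightarrow> complex"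
  assumes g: "\<And>l t. g l t \<in> field_gen F"
    and diag: "\<And>k. gram u v k k \<noteq> 0"
    and off_links: "\<And>k j. (k, j) \<notin> links g u v \<Longrightarrow> gram u v k j = 0"
    and align: "\<And>k j. k \<noteq> j \<Longrightarrow> (\<Sum>l\<in>UNIV. \<tau> (k, j, l) * branch_gram g u v l k j) = 0"
    and large: "CARD('t)\<^sup>2 + 8 * CARD('t) < 4 * CARD('k)"
  shows "\<exists>n < CARD('k \<times> 'k \<times> 'l). generated F n (range \<tau>)"
proof -
  define M where "M = gram u v"
  define N where "N = links g u v"
  have N_refl: "(k, k) \<in> N" for k using diag off_links unfolding N_def by blast
  have "\<exists>S. acyclic_in N S \<and> (\<forall>S'. acyclic_in N S' \<longrightarrow> card S' \<le> card S)"
    by (rule ex_has_greatest_nat[of _ "{}" _ "Suc CARD('k)"])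
      (auto simp: less_Suc_eq_le intro: acyclic_in.empty card_mono)
  then obtain S where S: "acyclic_in N S" and S_max: "\<And>S'. acyclic_in N S' \<Longrightarrow> card S' \<le> card S"
    by blast
  have "indep_rows S S M"
    by (rule acyclic_in_indep_rows[OF S]) (use diag off_links in \<open>auto simp: M_def N_def\<close>)
  then obtain I J where SIJ: "S \<subseteq> I" "S \<subseteq> J" and IJ: "card I = card J" "indep_rows I J M"
    and span: "\<forall>k. \<exists>c. \<forall>j. M k j = (\<Sum>i\<in>I. c i * M i j)"
    by (rule maximal_minor)
  obtain c where c: "\<And>k j. M k j = (\<Sum>i\<in>I. c k i * M i j)"
    using span by metis
  \<comment> \<open>A row vanishing on \<open>J\<close> would have zero coefficients and so vanish
    altogether, against its diagonal entry.\<close>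
  have "\<exists>j\<in>J. M k j \<noteq> 0" for k
  proof (rule ccontr)
    assume "\<not> ?thesis"
    then have "(\<Sum>i\<in>I. c k i * M i j) = 0" if "j \<in> J" for j
      using c[of k j] that by simp
    then have "c k i = 0" if "i \<in> I" for i
      using indep_rowsD[OF IJ(2), of "c k"] that by blast
    then show False using c[of k k] diag[of k] by (simp add: M_def)
  qed
  then obtain s where s: "\<And>k. s k \<in> J" "\<And>k. M k (s k) \<noteq> 0" by metis
  have "\<exists>i\<in>I. M i j \<noteq> 0" for j
  proof (rule ccontr)
    assume "\<not> ?thesis"
    then show False using c[of j j] diag[of j] by (simp add: M_def)
  qed
  then obtain s' where s': "\<And>j. s' j \<in> I" "\<And>j. M (s' j) j \<noteq> 0" by metis
  txt \<open>Rescaling the vectors saves one parameter for each user outside \<open>I\<close> and outside \<open>J\<close>.\<close>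
  define \<alpha> where "\<alpha> k = (if k \<in> I then 1 else M k (s k))" for k
  define \<beta> where "\<beta> j = (if j \<in> J then 1 else M (s' j) j)" for j
  have nz: "\<alpha> k \<noteq> 0" "\<beta> k \<noteq> 0" for k using s s' by (auto simp: \<alpha>_def \<beta>_def)
  define u' where "u' k t = u k t / \<alpha> k" for k t
  define v' where "v' j t = v j t / \<beta> j" for j t
  have gram': "gram u' v' k j = M k j / (\<alpha> k * \<beta> j)" for k j
    by (simp add: M_def gram_def u'_def v'_def sum_divide_distrib)
  have branch': "branch_gram g u' v' l k j = branch_gram g u v l k j / (\<alpha> k * \<beta> j)" for l k j
    by (simp add: branch_gram_def u'_def v'_def sum_divide_distrib)
  have links': "links g u' v' = N"
    using nz by (simp add: links_def branch' N_def)
  obtain n q where nq: "card I + q \<le> CARD('t)" "generated F n (range \<tau>)"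
    "int n \<le> int CARD('k \<times> 'k \<times> 'l) + int CARD('k) - int (card (N \<inter> (- I) \<times> (- J)))
      - 2 * (int CARD('k) - int (card I)) + int (card I) * int CARD('t)
      + (int CARD('k) + int q) * (int CARD('t) - int (card I))"
  proof -
    have "\<exists>n q. card I + q \<le> CARD('t) \<and> generated F n (range \<tau>) \<and>
      int n \<le> int CARD('k \<times> 'k \<times> 'l) + int CARD('k) - int (card (links g u' v' \<inter> (- I) \<times> (- J)))
        - 2 * (int CARD('k) - int (card I)) + int (card I) * int CARD('t)
        + (int CARD('k) + int q) * (int CARD('t) - int (card I))"
    proof (rule scheme_generated[OF g])
      show "(k, k) \<in> links g u' v'" for k by (simp add: links' N_refl)
      show "gram u' v' k j = 0" if "(k, j) \<notin> links g u' v'" for k j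
        using off_links that by (simp add: links' gram' N_def M_def)
      show "(\<Sum>l\<in>UNIV. \<tau> (k, j, l) * branch_gram g u' v' l k j) = 0" if "k \<noteq> j" for k j
        using align[OF that] by (simp add: branch' flip: sum_divide_distrib)
      show "card I = card J" by (rule IJ(1))
      show "indep_rows I J (gram u' v')"
        using IJ(2) by (simp add: indep_rows_def gram' \<alpha>_def \<beta>_def cong: sum.cong)
      show "\<exists>c. \<forall>j. gram u' v' k j = (\<Sum>i\<in>I. c i * gram u' v' i j)" for k
      proof (intro exI allI)
        fix j
        have "gram u' v' k j = (\<Sum>i\<in>I. c k i * M i j) / (\<alpha> k * \<beta> j)"
          by (simp only: gram' c[of k j])
        also have "\<dots> = (\<Sum>i\<in>I. c k i / \<alpha> k * gram u' v' i j)"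
          unfolding sum_divide_distrib by (intro sum.cong) (auto simp: gram' \<alpha>_def)
        finally show "gram u' v' k j = (\<Sum>i\<in>I. c k i / \<alpha> k * gram u' v' i j)" .
      qed
      show "\<exists>j\<in>J. gram u' v' k j = 1" if "k \<notin> I" for k
        using s[of k] that by (intro bexI[of _ "s k"]) (auto simp: gram' \<alpha>_def \<beta>_def)
      show "\<exists>i\<in>I. gram u' v' i j = 1" if "j \<notin> J" for j
        using s'[of j] that by (intro bexI[of _ "s' j"]) (auto simp: gram' \<alpha>_def \<beta>_def)
    qed
    then show ?thesis using that unfolding links' by blast
  qed
  define X where "X = - (I \<union> J)"
  have "card S \<le> card (I \<inter> J)" using SIJ by (intro card_mono) auto
  then have "card (I \<union> J) + card S \<le> 2 * card I"
    using card_Un_Int[of I J] IJ(1) by simp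
  moreover have "card X + card (I \<union> J) = CARD('k)"
    unfolding X_def using card_mono[of UNIV "I \<union> J"]
    by (simp add: Compl_eq_Diff_UNIV card_Diff_subset)
  ultimately have X: "CARD('k) + card S \<le> card X + 2 * card I" by linarith
  obtain S' where S': "acyclic_in N S'" "(card X)\<^sup>2 \<le> card S' * card (N \<inter> X \<times> X)"
    using acyclic_in_card[OF N_refl] by blast
  have X2: "(card X)\<^sup>2 \<le> card S * card (N \<inter> (- I) \<times> (- J))"
  proof -
    have "card (N \<inter> X \<times> X) \<le> card (N \<inter> (- I) \<times> (- J))"
      by (intro card_mono) (auto simp: X_def)
    with S'(2) S_max[OF S'(1)] show ?thesis
      by (meson le_trans mult_le_mono)
  qed
  \<comment> \<open>From \<open>(T - 2)^2 \<ge> 0\<close> one gets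
    \<open>12 * T \<le> 4 * K + 3\<close>, and divisibility by 4 removes the 3.\<close>
  have K3: "3 * CARD('t) \<le> CARD('k)"
  proof -
    have "0 \<le> (int CARD('t) - 2)\<^sup>2" by simp
    then have "12 * int CARD('t) \<le> int (CARD('t)\<^sup>2 + 8 * CARD('t)) + 4"
      by (simp add: power2_eq_square algebra_simps)
    moreover have "int (CARD('t)\<^sup>2 + 8 * CARD('t)) < int (4 * CARD('k))"
      using large by (simp only: of_nat_less_iff)
    ultimately show ?thesis by presburger
  qed
  have "card S > 0"
  proof -
    have "(0::nat) < CARD('t)" by simp
    then have "card X > 0" using X K3 nq(1) by linarith
    then have "0 < (card X)\<^sup>2" by simp
    with X2 show ?thesis by (metis gr0I le_zero_eq mult_is_0 less_irrefl)
  qed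
  have "- real CARD('k) + 2 * real (card I) + real (card I) * real CARD('t)
      + (real CARD('k) + real q) * (real CARD('t) - real (card I)) < real (card (N \<inter> (- I) \<times> (- J)))"
  proof (rule counting_inequality[of "real (card S)" _ _ _ _ "real (card X)"])
    show "real (card S) \<le> real (card I)" using SIJ by (simp add: card_mono)
    show "real (card I) + real q \<le> real CARD('t)" using nq(1) by (simp flip: of_nat_add)
    show "3 * real (card I) \<le> real CARD('k)" using K3 nq(1) by linarith
    have "real (CARD('t)\<^sup>2 + 8 * CARD('t) + 1) \<le> real (4 * CARD('k))"
      using large by (simp only: of_nat_le_iff)
    then show "(real CARD('t))\<^sup>2 + 8 * real CARD('t) + 1 \<le> 4 * real CARD('k)" by simp
    show "real CARD('k) - 2 * real (card I) + real (card S) \<le> real (card X)"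
      using X by linarith
    show "(real (card X))\<^sup>2 \<le> real (card S) * real (card (N \<inter> (- I) \<times> (- J)))"
      using X2 by (simp flip: of_nat_power of_nat_mult)
  qed (use \<open>card S > 0\<close> in auto)
  then have "real_of_int (- int CARD('k) + 2 * int (card I) + int (card I) * int CARD('t)
      + (int CARD('k) + int q) * (int CARD('t) - int (card I))) < real_of_int (int (card (N \<inter> (- I) \<times> (- J))))"
    by simp
  then have less: "- int CARD('k) + 2 * int (card I) + int (card I) * int CARD('t)
      + (int CARD('k) + int q) * (int CARD('t) - int (card I)) < int (card (N \<inter> (- I) \<times> (- J)))"
    by (simp only: of_int_less_iff)
  have "x < t" if "- k + 2 * r + y + z < m" "x \<le> t + k - m - 2 * (k - r) + y + z" for x t k r y z m :: int
    using that by presburger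
  from this[OF less nq(3)] have "n < CARD('k \<times> 'k \<times> 'l)"
    by (simp only: of_nat_less_iff)
  then show ?thesis using nq(2) by auto
qed

subsection \<open>Diagonal channels\<close>

text \<open>Distinct exponents make the \<open>y i l\<close> the coefficients of a nonzero
  polynomial, which has finitely many roots. A natural number \<open>m\<close> is chosen because it
  lies in every generated field.\<close>

lemma generic_power_combination:
  fixes y :: "'i \<Rightarrow> 'l::finite \<Rightarrow> complex" and e :: "'l \<Rightarrow> nat"
  assumes "finite I" "inj e" "\<And>i. i \<in> I \<Longrightarrow> \<exists>l. y i l \<noteq> 0"
  shows "\<exists>m :: nat. \<forall>i\<in>I. (\<Sum>l\<in>UNIV. of_nat m ^ e l * y i l) \<noteq> 0"
proof -
  define p where "p i = (\<Sum>l\<in>UNIV. monom (y i l) (e l))" for i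
  have "coeff (p i) (e l) = y i l" for i l
  proof -
    have "coeff (p i) (e l) = (\<Sum>l'\<in>UNIV. if l' = l then y i l' else 0)"
      unfolding p_def coeff_sum using assms(2) by (intro sum.cong) (auto simp: inj_eq)
    then show ?thesis by simp
  qed
  then have "p i \<noteq> 0" if "i \<in> I" for i
    using assms(3)[OF that] by (metis coeff_0)
  then have "finite (\<Union>i\<in>I. {z. poly (p i) z = 0})"
    using assms(1) by (auto intro: poly_roots_finite)
  moreover have "infinite (range (of_nat :: nat \<Rightarrow> complex))"
    by (simp add: finite_image_iff inj_of_nat)
  ultimately obtain z :: complex where "z \<in> range of_nat" "z \<notin> (\<Union>i\<in>I. {z. poly (p i) z = 0})"
    by (meson finite_subset subsetI)
  then show ?thesis
    by (auto simp: p_def poly_sum poly_monom mult.commute)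
qed

lemma mat_lincomb_diagonal_mult:
  assumes "\<And>l. diagonal_matrix (A l)"
  shows "(mat_lincomb c A *v w) $ a = (\<Sum>l\<in>UNIV. c l * A l $ a $ a) * w $ a"
proof -
  have "mat_lincomb c A $ a $ b * w $ b = (if b = a then mat_lincomb c A $ a $ a * w $ a else 0)" for b
    using assms by (auto simp: mat_lincomb_def diagonal_matrix_def)
  then have "(mat_lincomb c A *v w) $ a
      = (\<Sum>b\<in>UNIV. if b = a then mat_lincomb c A $ a $ a * w $ a else 0)"
    unfolding matrix_vector_mult_def vec_lambda_beta by (intro sum.cong refl)
  then show ?thesis by (simp add: mat_lincomb_def)
qed

text \<open>Otherwise row \<open>a\<close> of every combination is zero, and the other rows are too
  few for full rank.\<close>

lemma Psi_diagonal_nonzero: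
  fixes A :: "'l::finite \<Rightarrow> complex^'t^'t"
  assumes "\<And>l. diagonal_matrix (A l)" "A \<in> Psi"
  shows "\<exists>l. A l $ a $ a \<noteq> 0"
proof (rule ccontr)
  assume 0: "\<not> ?thesis"
  obtain c where c: "rank (mat_lincomb c A) = CARD('t)"
    using assms(2) by (auto simp: Psi_def)
  have "row a (mat_lincomb c A) = 0"
  proof -
    have "A l $ a $ b = 0" for l b
      using 0 assms(1)[of l] by (cases "a = b") (auto simp: diagonal_matrix_def)
    then show ?thesis by (simp add: row_def mat_lincomb_def vec_eq_iff)
  qed
  then have "rows (mat_lincomb c A) \<subseteq> insert 0 ((\<lambda>b. row b (mat_lincomb c A)) ` (UNIV - {a}))"
    by (auto simp: rows_def)
  then have "rows (mat_lincomb c A) \<subseteq> vec.span ((\<lambda>b. row b (mat_lincomb c A)) ` (UNIV - {a}))"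
    by (auto intro: vec.span_base vec.span_zero)
  then have "rank (mat_lincomb c A) \<le> card ((\<lambda>b. row b (mat_lincomb c A)) ` (UNIV - {a}))"
    unfolding row_rank_def_gen by (intro vec.dim_le_card) auto
  also have "\<dots> < CARD('t)"
    by (rule le_less_trans[OF card_image_le]) (auto intro!: psubset_card_mono)
  finally show False using c by simp
qed

lemma card_branches_le:
  fixes A :: "'l::finite \<Rightarrow> complex^'t^'t"
  assumes "lin_indep_mats A" "\<And>l. diagonal_matrix (A l)"
  shows "CARD('l) \<le> CARD('t)"
proof (rule indep_rows_card)
  show "indep_rows (UNIV :: 'l set) (UNIV :: 't set) (\<lambda>l t. A l $ t $ t)"
    unfolding indep_rows_def
  proof (intro allI impI ballI)
    fix c l assume c: "\<forall>t\<in>UNIV. (\<Sum>l\<in>UNIV. c l * A l $ t $ t) = 0"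
    have "mat_lincomb c A $ a $ b = 0" for a b
      using c assms(2) by (cases "a = b") (auto simp: mat_lincomb_def diagonal_matrix_def)
    then have "mat_lincomb c A = 0" by (simp add: vec_eq_iff)
    with assms(1) show "c l = 0" by (simp add: lin_indep_mats_def)
  qed
qed auto

lemma herm_prod_channel:
  assumes "\<And>l. diagonal_matrix (A l)"
  shows "herm_prod x (channel A \<tau> k j *v y)
    = (\<Sum>l\<in>UNIV. \<tau> $ (k, j, l) * (\<Sum>a\<in>UNIV. A l $ a $ a * cnj (x $ a) * y $ a))"
proof -
  have "herm_prod x (channel A \<tau> k j *v y)
      = (\<Sum>a\<in>UNIV. \<Sum>l\<in>UNIV. \<tau> $ (k, j, l) * (A l $ a $ a * cnj (x $ a) * y $ a))"
    unfolding herm_prod_def channel_def mat_lincomb_diagonal_mult[OF assms]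
    by (simp add: sum_distrib_left sum_distrib_right mult_ac)
  then show ?thesis
    by (subst (asm) sum.swap) (simp add: sum_distrib_left)
qed

section \<open>Generic coefficients and the final bound\<close>

lemma generic_scheme_bound:
  fixes A :: "'l::finite \<Rightarrow> complex^'t^'t" and \<tau> :: "complex^('k::finite \<times> 'k \<times> 'l)"
  assumes diag: "\<And>l. diagonal_matrix (A l)" and Psi: "A \<in> Psi"
    and F: "\<And>l a. A l $ a $ a \<in> F"
    and generic: "\<not> (\<exists>P. finite P \<and> card P < CARD('k \<times> 'k \<times> 'l) \<and> (\<forall>i. \<tau> $ i \<in> field_gen (F \<union> P)))"
    and scheme: "single_beam_IA_scheme (channel A \<tau>) v u"
  shows "4 * CARD('k) \<le> 4 * CARD('l) * CARD('t) + CARD('t)\<^sup>2"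
proof -
  define b where "b l k j = (\<Sum>a\<in>UNIV. A l $ a $ a * cnj (u k $ a) * v j $ a)" for l k j
  have align: "(\<Sum>l\<in>UNIV. \<tau> $ (k, j, l) * b l k j) = 0" if "k \<noteq> j" for k j
    using scheme that unfolding single_beam_IA_scheme_def herm_prod_channel[OF diag] b_def by blast
  have "(\<Sum>l\<in>UNIV. \<tau> $ (k, k, l) * b l k k) \<noteq> 0" for k
    using scheme unfolding single_beam_IA_scheme_def herm_prod_channel[OF diag] b_def by blast
  then have b_diag: "\<exists>l. b l k k \<noteq> 0" for k
    by (metis (no_types, lifting) mult_zero_right sum.neutral)
  txt \<open>One combination of the branches that is invertible and keeps every desired signal.\<close>
  define y where "y = case_sum (\<lambda>a l. A l $ a $ a) (\<lambda>k l. b l k k)"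
  have "\<exists>l. y i l \<noteq> 0" for i
    using Psi_diagonal_nonzero[OF diag Psi] b_diag by (cases i) (auto simp: y_def)
  then obtain m :: nat where m: "\<And>i. (\<Sum>l\<in>UNIV. of_nat m ^ to_nat l * y i l) \<noteq> 0"
    using generic_power_combination[of UNIV to_nat y] by auto
  define D where "D a = (\<Sum>l\<in>UNIV. of_nat m ^ to_nat l * A l $ a $ a)" for a
  have D: "D a \<noteq> 0" for a
    using m[of "Inl a"] by (simp add: D_def y_def)
  define u' where "u' k a = cnj (u k $ a) * D a" for k a
  define v' where "v' k a = v k $ a" for k a
  define g where "g l a = A l $ a $ a / D a" for l a
  have branch: "branch_gram g u' v' l k j = b l k j" for l k j
    unfolding branch_gram_def g_def u'_def v'_def b_def using D by (intro sum.cong) auto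
  have gram: "gram u' v' k j = (\<Sum>l\<in>UNIV. of_nat m ^ to_nat l * b l k j)" for k j
    unfolding gram_def u'_def v'_def D_def b_def sum_distrib_left sum_distrib_right
    by (subst sum.swap) (simp add: mult_ac)
  have gram_diag: "gram u' v' k k \<noteq> 0" for k
    using m[of "Inr k"] by (simp add: gram y_def)
  have g_F: "g l a \<in> field_gen F" for l a
    unfolding g_def D_def using F
    by (auto intro!: field_gen_divide field_gen_sum field_gen.mult field_gen_power field_gen_of_nat
        intro: field_gen.gen)
  have "CARD('l) = 1 \<or> 2 \<le> CARD('l)"
    using zero_less_card_finite[where 'a = 'l] by linarith
  then show ?thesis
  proof
    assume "CARD('l) = 1"
    then obtain l0 :: 'l where l0: "UNIV = {l0}"
      by (auto simp: card_1_singleton_iff)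
    \<comment> \<open>If one coefficient were zero, the others would generate all of them, against
      genericity.\<close>
    have "\<tau> $ i \<noteq> 0" for i
    proof
      assume i: "\<tau> $ i = 0"
      have "\<tau> $ i' \<in> field_gen (F \<union> ($) \<tau> ` (UNIV - {i}))" for i'
        using i by (cases "i' = i") (auto intro: field_gen.zero field_gen.gen)
      moreover have "card (($) \<tau> ` (UNIV - {i})) < CARD('k \<times> 'k \<times> 'l)"
        by (rule le_less_trans[OF card_image_le]) (auto intro!: psubset_card_mono)
      ultimately have "\<exists>P. finite P \<and> card P < CARD('k \<times> 'k \<times> 'l) \<and> (\<forall>i. \<tau> $ i \<in> field_gen (F \<union> P))"
        by (intro exI[of _ "($) \<tau> ` (UNIV - {i})"]) simp
      with generic show False ..
    qed
    \<comment> \<open>With a single branch the alignment equation is one product with a nonzero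
      coefficient, so the Gram matrix is diagonal.\<close>
    then have "b l0 k j = 0" if "k \<noteq> j" for k j
      using align[OF that] by (simp add: l0)
    then have off: "gram u' v' k j = 0" if "k \<noteq> j" for k j
      using that by (simp add: gram l0)
    have "indep_rows (UNIV :: 'k set) UNIV u'"
      unfolding indep_rows_def
    proof (intro allI impI ballI)
      fix c j assume c: "\<forall>a\<in>UNIV. (\<Sum>k\<in>UNIV. c k * u' k a) = 0"
      have "(\<Sum>k\<in>UNIV. c k * gram u' v' k j) = (\<Sum>a\<in>UNIV. (\<Sum>k\<in>UNIV. c k * u' k a) * v' j a)"
        unfolding gram_def sum_distrib_left sum_distrib_right
        by (subst sum.swap) (simp add: mult.assoc)
      also have "\<dots> = 0" using c by simp
      also have "(\<Sum>k\<in>UNIV. c k * gram u' v' k j)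
          = (\<Sum>k\<in>UNIV. if k = j then c j * gram u' v' j j else 0)"
        using off by (intro sum.cong) auto
      finally show "c j = 0" using gram_diag[of j] by simp
    qed
    then have "CARD('k) \<le> CARD('t)"
      using indep_rows_card[of UNIV UNIV u'] by simp
    then show ?thesis using \<open>CARD('l) = 1\<close> by simp
  next
    assume L: "2 \<le> CARD('l)"
    show ?thesis
    proof (rule ccontr)
      assume "\<not> ?thesis"
      \<comment> \<open>Two branches are what brings the bound up to the threshold of
        \<open>scheme_bound\<close>.\<close>
      moreover have "8 * CARD('t) \<le> 4 * CARD('l) * CARD('t)"
        using L by (intro mult_right_mono) auto
      ultimately have large: "CARD('t)\<^sup>2 + 8 * CARD('t) < 4 * CARD('k)" by linarith
      have "\<exists>n < CARD('k \<times> 'k \<times> 'l). generated F n (range (($) \<tau>))"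
      proof (rule scheme_bound[OF g_F gram_diag])
        show "gram u' v' k j = 0" if "(k, j) \<notin> links g u' v'" for k j
          using that by (simp add: links_def branch gram)
        show "(\<Sum>l\<in>UNIV. \<tau> $ (k, j, l) * branch_gram g u' v' l k j) = 0" if "k \<noteq> j" for k j
          using align[OF that] by (simp add: branch)
      qed (rule large)
      then obtain n P where "n < CARD('k \<times> 'k \<times> 'l)" "finite P" "card P \<le> n"
          "range (($) \<tau>) \<subseteq> field_gen (F \<union> P)"
        unfolding generated_def by blast
      then have "finite P \<and> card P < CARD('k \<times> 'k \<times> 'l) \<and> (\<forall>i. \<tau> $ i \<in> field_gen (F \<union> P))"
        by auto
      with generic show False by blast
    qed
  qed
qed

theorem corollary3p1:
  fixes A :: "'l::finite \<Rightarrow> complex^'t^'t"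
    and d :: "'k::finite \<Rightarrow> nat"
  assumes "lin_indep_mats A"
    and "\<And>l. diagonal_matrix (A l)"
    and "A \<in> Psi"
    and "\<And>k. d k = 1"
  shows "AE \<tau> in (lebesgue :: (complex^('k \<times> 'k \<times> 'l)) measure).
           \<forall>v u. single_beam_IA_scheme (channel A \<tau>) v u \<longrightarrow>
             dof d CARD('t) \<le>
               min (sqrt (5 / 4 * real CARD('k))) (real CARD('l) + 1 / 4 * real CARD('t))"
proof -
  define F where "F = range (\<lambda>(l, a). A l $ a $ a)"
  have F: "A l $ a $ a \<in> F" for l a unfolding F_def by force
  have "countable F" unfolding F_def by (intro countable_finite finite_imageI) simp
  from AE_not_generated[OF this] show ?thesis
  proof (rule AE_mp, intro AE_I2 impI allI)
    fix \<tau> :: "complex^('k \<times> 'k \<times> 'l)" and v u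
    assume generic: "\<not> (\<exists>P. finite P \<and> card P < CARD('k \<times> 'k \<times> 'l) \<and> (\<forall>i. \<tau> $ i \<in> field_gen (F \<union> P)))"
      and scheme: "single_beam_IA_scheme (channel A \<tau>) v u"
    define K L T where "K = real CARD('k)" and "L = real CARD('l)" and "T = real CARD('t)"
    have "T > 0" by (simp add: T_def)
    have "real (4 * CARD('k)) \<le> real (4 * CARD('l) * CARD('t) + CARD('t)\<^sup>2)"
      using generic_scheme_bound[OF assms(2,3) F generic scheme] by (simp only: of_nat_le_iff)
    then have K: "K \<le> (L + 1 / 4 * T) * T"
      by (simp add: K_def L_def T_def algebra_simps power2_eq_square)
    \<comment> \<open>Independent diagonal matrices number at most \<open>T\<close>; this removes
      \<open>L\<close> from the bound, and squaring \<open>K / T\<close> then removes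
      \<open>T\<close>.\<close>
    have "L \<le> T"
      using card_branches_le[OF assms(1,2)] by (simp add: L_def T_def)
    then have K': "K \<le> 5 / 4 * T * T"
      using K \<open>T > 0\<close> mult_right_mono[of "L + 1 / 4 * T" "5 / 4 * T" T] by linarith
    have dof: "dof d CARD('t) = K / T"
      using assms(4) by (simp add: dof_def K_def T_def)
    have "K / T \<le> L + 1 / 4 * T"
      using K \<open>T > 0\<close> by (simp add: pos_divide_le_eq)
    moreover have "K / T \<le> sqrt (5 / 4 * K)"
    proof (rule real_le_rsqrt)
      have "(K / T)\<^sup>2 = K * (K / (T * T))" by (simp add: power2_eq_square)
      also have "\<dots> \<le> K * (5 / 4)"
        using K' \<open>T > 0\<close> by (intro mult_left_mono) (simp_all add: pos_divide_le_eq K_def mult.assoc)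
      finally show "(K / T)\<^sup>2 \<le> 5 / 4 * K" by simp
    qed
    ultimately show "dof d CARD('t) \<le> min (sqrt (5 / 4 * real CARD('k))) (real CARD('l) + 1 / 4 * real CARD('t))"
      by (simp add: dof K_def L_def T_def)
  qed
qed

end
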